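(* Let $A$ be an abelian group, let $G$ and $H$ be finite groups and let $(K,\kappa)\in\mathcal{M}_G^G$ and $(L,\lambda)\in\mathcal{M}_H^H$. Assume that $\kappa$ and $\lambda$ are faithful (injective) and let $\alpha\in Z^2(G/K,K)$ and $\beta\in Z^2(H/L,L)$ be cocycles which describe the central extensions $1\to K\to G\to G/K\to1$ and $1\to L\to H\to H/L\to1$, respectively. Then the following are equivalent: (i) $(G,K,\kappa)\sim(H,L,\lambda)$, i.e. the two triples are linked. (ii) There exists an isomorphism $\eta\colon H/L\to G/K$ such that $[\kappa\circ\alpha]=[\lambda\circ\beta\circ(\eta^{-1}\times\eta^{-1})]$ as elements of $H^2(G/K,\mathrm{tor}A)$.
   Context: $A$ is written multiplicatively, $\mathrm{tor}A$ is its torsion subgroup, with trivial action of $G/K$. For a finite group $K$, $K^*=\mathrm{Hom}(K,A)$. $\mathcal{M}_G$ is the set of pairs $(K,\kappa)$ with $K\le G$, $\kappa\in K^*$; $\mathcal{M}_G^G$ is the subset of pairs with $K\trianglelefteq G$ and $\kappa(gxg^{-1})=\kappa(x)$ for all $g\in G,x\in K$ (so $K\le Z(G)$ if $\kappa$ is injective). For $(U,\phi)\in\mathcal{M}_{G\times H}$: $p_1(U)\le G$, $p_2(U)\le H$ are the projections, $k_1(U)=\{g:(g,1)\in U\}$, $k_2(U)=\{h:(1,h)\in U\}$, and $\phi_i\in k_i(U)^*$ are defined by $\phi(g,h)=\phi_1(g)\phi_2(h)^{-1}$ on $k_1(U)\times k_2(U)$. The triples $(G,K,\kappa)$ and $(H,L,\lambda)$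 are linked if there exists $(U,\phi)\in\mathcal{M}_{G\times H}$ with $(p_1(U),k_1(U),\phi_1)=(G,K,\kappa)$ and $(p_2(U),k_2(U),\phi_2)=(H,L,\lambda)$. For $K\le Z(G)$, a cocycle $\alpha\in Z^2(G/K,K)$ (trivial action) describes the central extension $1\to K\to G\to G/K\to1$ if there is a set-theoretic section $\sigma\colon G/K\to G$ of the canonical epimorphism with $\sigma(x)\sigma(y)=\alpha(x,y)\sigma(xy)$ for all $x,y\in G/K$. *)

theory Defs
  imports "HOL-Algebra.Algebra"
begin

section \<open>Characters with values in an abelian group\<close>

text \<open>The set $K^* = \mathrm{Hom}(K,A)$. A homomorphism is represented by the unique function that
  is \<^const>\<open>undefined\<close> outside the carrier of \<open>K\<close>, so that equality of elements of $K^*$ is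
  equality of HOL functions.\<close>

definition dual :: "('a, 'n) monoid_scheme \<Rightarrow> ('k, 'm) monoid_scheme \<Rightarrow> ('k \<Rightarrow> 'a) set" where
  "dual A K = hom K A \<inter> extensional (carrier K)"

definition char_pairs ::
  "('a, 'n) monoid_scheme \<Rightarrow> ('g, 'm) monoid_scheme \<Rightarrow> ('g set \<times> ('g \<Rightarrow> 'a)) set" where
  "char_pairs A G = {(K, \<kappa>). subgroup K G \<and> \<kappa> \<in> dual A (G\<lparr>carrier := K\<rparr>)}"

definition fixed_char_pairs ::
  "('a, 'n) monoid_scheme \<Rightarrow> ('g, 'm) monoid_scheme \<Rightarrow> ('g set \<times> ('g \<Rightarrow> 'a)) set" where
  "fixed_char_pairs A G = {(K, \<kappa>) \<in> char_pairs A G. K \<lhd> G \<and>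
     (\<forall>g \<in> carrier G. \<forall>x \<in> K. \<kappa> (g \<otimes>\<^bsub>G\<^esub> x \<otimes>\<^bsub>G\<^esub> inv\<^bsub>G\<^esub> g) = \<kappa> x)}"


section \<open>Linked triples\<close>

definition p1 :: "('g \<times> 'h) set \<Rightarrow> 'g set" where
  "p1 U = fst ` U"

definition p2 :: "('g \<times> 'h) set \<Rightarrow> 'h set" where
  "p2 U = snd ` U"

definition k1 :: "('h, 'm) monoid_scheme \<Rightarrow> ('g \<times> 'h) set \<Rightarrow> 'g set" where
  "k1 H U = {g. (g, \<one>\<^bsub>H\<^esub>) \<in> U}"

definition k2 :: "('g, 'm) monoid_scheme \<Rightarrow> ('g \<times> 'h) set \<Rightarrow> 'h set" where
  "k2 G U = {h. (\<one>\<^bsub>G\<^esub>, h) \<in> U}"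

text \<open>The characters \<open>\<phi>\<^sub>1\<close> and \<open>\<phi>\<^sub>2\<close> are determined by
  $\phi(g,h) = \phi_1(g)\,\phi_2(h)^{-1}$ on $k_1(U) \times k_2(U)$: put \<open>h = 1\<close>, respectively
  \<open>g = 1\<close>. Note the inverse in \<open>\<phi>\<^sub>2\<close>. The lemmas \<open>phi_characterization\<close> and
  \<open>phi_dual\<close> state existence and uniqueness.\<close>

definition phi1 ::
  "('h, 'm) monoid_scheme \<Rightarrow> ('g \<times> 'h) set \<Rightarrow> ('g \<times> 'h \<Rightarrow> 'a) \<Rightarrow> 'g \<Rightarrow> 'a" where
  "phi1 H U \<phi> = (\<lambda>g \<in> k1 H U. \<phi> (g, \<one>\<^bsub>H\<^esub>))"

definition phi2 ::
  "('a, 'n) monoid_scheme \<Rightarrow> ('g, 'm) monoid_scheme \<Rightarrow> ('g \<times> 'h) set \<Rightarrow> ('g \<times> 'h \<Rightarrow> 'a)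
     \<Rightarrow> 'h \<Rightarrow> 'a" where
  "phi2 A G U \<phi> = (\<lambda>h \<in> k2 G U. inv\<^bsub>A\<^esub> (\<phi> (\<one>\<^bsub>G\<^esub>, h)))"

lemma phi_characterization:
  assumes A: "comm_group A" and G: "group G" and H: "group H"
    and U: "(U, \<phi>) \<in> char_pairs A (G \<times>\<times> H)"
    and f1: "f1 \<in> dual A (G\<lparr>carrier := k1 H U\<rparr>)" and f2: "f2 \<in> dual A (H\<lparr>carrier := k2 G U\<rparr>)"
  shows "(\<forall>g \<in> k1 H U. \<forall>h \<in> k2 G U. \<phi> (g, h) = f1 g \<otimes>\<^bsub>A\<^esub> inv\<^bsub>A\<^esub> f2 h) \<longleftrightarrow>
         f1 = phi1 H U \<phi> \<and> f2 = phi2 A G U \<phi>" (is "?L \<longleftrightarrow> ?R")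
proof -
  interpret A: comm_group A by fact
  interpret G: group G by fact
  interpret H: group H by fact
  have sU: "subgroup U (G \<times>\<times> H)" and hom: "\<phi> \<in> hom ((G \<times>\<times> H)\<lparr>carrier := U\<rparr>) A"
    using U by (auto simp: char_pairs_def dual_def)
  have subU: "U \<subseteq> carrier G \<times> carrier H" using subgroup.subset[OF sU] by simp
  have one: "(\<one>\<^bsub>G\<^esub>, \<one>\<^bsub>H\<^esub>) \<in> U" using subgroup.one_closed[OF sU] by simp
  hence o1: "\<one>\<^bsub>G\<^esub> \<in> k1 H U" and o2: "\<one>\<^bsub>H\<^esub> \<in> k2 G U" by (auto simp: k1_def k2_def)
  have clU: "\<phi> u \<in> carrier A" if "u \<in> U" for u using hom that by (auto simp: hom_def)
  have c1: "f1 g \<in> carrier A" if "g \<in> k1 H U" for g using f1 that by (auto simp: dual_def hom_def)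
  have c2: "f2 h \<in> carrier A" if "h \<in> k2 G U" for h using f2 that by (auto simp: dual_def hom_def)
  have "f1 (\<one>\<^bsub>G\<^esub> \<otimes>\<^bsub>G\<^esub> \<one>\<^bsub>G\<^esub>) = f1 \<one>\<^bsub>G\<^esub> \<otimes>\<^bsub>A\<^esub> f1 \<one>\<^bsub>G\<^esub>"
    using f1 o1 unfolding dual_def hom_def by fastforce
  hence e1: "f1 \<one>\<^bsub>G\<^esub> = \<one>\<^bsub>A\<^esub>" using c1[OF o1] by simp
  have "f2 (\<one>\<^bsub>H\<^esub> \<otimes>\<^bsub>H\<^esub> \<one>\<^bsub>H\<^esub>) = f2 \<one>\<^bsub>H\<^esub> \<otimes>\<^bsub>A\<^esub> f2 \<one>\<^bsub>H\<^esub>"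
    using f2 o2 unfolding dual_def hom_def by fastforce
  hence e2: "f2 \<one>\<^bsub>H\<^esub> = \<one>\<^bsub>A\<^esub>" using c2[OF o2] by simp
  have x1: "f1 \<in> extensional (k1 H U)" and x2: "f2 \<in> extensional (k2 G U)"
    using f1 f2 by (auto simp: dual_def)
  show ?thesis
  proof
    assume L: ?L
    have "f1 g = \<phi> (g, \<one>\<^bsub>H\<^esub>)" if "g \<in> k1 H U" for g
      using L that o2 e2 c1[OF that] by simp
    moreover have "f2 h = inv\<^bsub>A\<^esub> (\<phi> (\<one>\<^bsub>G\<^esub>, h))" if "h \<in> k2 G U" for h
      using L that o1 e1 c2[OF that] by simp
    ultimately show ?R
      using x1 x2 by (auto simp: phi1_def phi2_def extensional_def fun_eq_iff)
  next
    assume R: ?R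
    show ?L
    proof (intro ballI)
      fix g h assume g: "g \<in> k1 H U" and h: "h \<in> k2 G U"
      hence gU: "(g, \<one>\<^bsub>H\<^esub>) \<in> U" and hU: "(\<one>\<^bsub>G\<^esub>, h) \<in> U" by (auto simp: k1_def k2_def)
      hence gc: "g \<in> carrier G" and hc: "h \<in> carrier H" using subU by auto
      have "\<phi> ((g, \<one>\<^bsub>H\<^esub>) \<otimes>\<^bsub>G \<times>\<times> H\<^esub> (\<one>\<^bsub>G\<^esub>, h)) = \<phi> (g, \<one>\<^bsub>H\<^esub>) \<otimes>\<^bsub>A\<^esub> \<phi> (\<one>\<^bsub>G\<^esub>, h)"
        using hom gU hU unfolding hom_def by fastforce
      thus "\<phi> (g, h) = f1 g \<otimes>\<^bsub>A\<^esub> inv\<^bsub>A\<^esub> f2 h"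
        using R g h gc hc clU[OF hU] by (simp add: phi1_def phi2_def)
    qed
  qed
qed

lemma phi_dual:
  assumes A: "comm_group A" and G: "group G" and H: "group H"
    and U: "(U, \<phi>) \<in> char_pairs A (G \<times>\<times> H)"
  shows "phi1 H U \<phi> \<in> dual A (G\<lparr>carrier := k1 H U\<rparr>)"
    and "phi2 A G U \<phi> \<in> dual A (H\<lparr>carrier := k2 G U\<rparr>)"
proof -
  interpret A: comm_group A by fact
  interpret G: group G by fact
  interpret H: group H by fact
  have sU: "subgroup U (G \<times>\<times> H)" and hom: "\<phi> \<in> hom ((G \<times>\<times> H)\<lparr>carrier := U\<rparr>) A"
    using U by (auto simp: char_pairs_def dual_def)
  have clU: "\<phi> u \<in> carrier A" if "u \<in> U" for u using hom that by (auto simp: hom_def)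
  have mU: "(a \<otimes>\<^bsub>G\<^esub> c, b \<otimes>\<^bsub>H\<^esub> d) \<in> U"
    and hU: "\<phi> (a \<otimes>\<^bsub>G\<^esub> c, b \<otimes>\<^bsub>H\<^esub> d) = \<phi> (a, b) \<otimes>\<^bsub>A\<^esub> \<phi> (c, d)"
    if "(a, b) \<in> U" "(c, d) \<in> U" for a b c d
  proof -
    show "(a \<otimes>\<^bsub>G\<^esub> c, b \<otimes>\<^bsub>H\<^esub> d) \<in> U" using subgroup.m_closed[OF sU that] by simp
    have "\<phi> ((a, b) \<otimes>\<^bsub>G \<times>\<times> H\<^esub> (c, d)) = \<phi> (a, b) \<otimes>\<^bsub>A\<^esub> \<phi> (c, d)"
      using hom that unfolding hom_def by fastforce
    thus "\<phi> (a \<otimes>\<^bsub>G\<^esub> c, b \<otimes>\<^bsub>H\<^esub> d) = \<phi> (a, b) \<otimes>\<^bsub>A\<^esub> \<phi> (c, d)" by simp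
  qed
  have 1: "x \<otimes>\<^bsub>G\<^esub> y \<in> k1 H U \<and> \<phi> (x \<otimes>\<^bsub>G\<^esub> y, \<one>\<^bsub>H\<^esub>) = \<phi> (x, \<one>\<^bsub>H\<^esub>) \<otimes>\<^bsub>A\<^esub> \<phi> (y, \<one>\<^bsub>H\<^esub>)"
    if "x \<in> k1 H U" "y \<in> k1 H U" for x y
    using mU[of x "\<one>\<^bsub>H\<^esub>" y "\<one>\<^bsub>H\<^esub>"] hU[of x "\<one>\<^bsub>H\<^esub>" y "\<one>\<^bsub>H\<^esub>"] that by (simp add: k1_def)
  show "phi1 H U \<phi> \<in> dual A (G\<lparr>carrier := k1 H U\<rparr>)"
    using 1 clU by (auto simp: dual_def hom_def phi1_def k1_def)
  have 2: "x \<otimes>\<^bsub>H\<^esub> y \<in> k2 G U \<and> \<phi> (\<one>\<^bsub>G\<^esub>, x \<otimes>\<^bsub>H\<^esub> y) = \<phi> (\<one>\<^bsub>G\<^esub>, x) \<otimes>\<^bsub>A\<^esub> \<phi> (\<one>\<^bsub>G\<^esub>, y)"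
    if "x \<in> k2 G U" "y \<in> k2 G U" for x y
    using mU[of "\<one>\<^bsub>G\<^esub>" x "\<one>\<^bsub>G\<^esub>" y] hU[of "\<one>\<^bsub>G\<^esub>" x "\<one>\<^bsub>G\<^esub>" y] that by (simp add: k2_def)
  show "phi2 A G U \<phi> \<in> dual A (H\<lparr>carrier := k2 G U\<rparr>)"
    using 2 clU by (auto simp: dual_def hom_def phi2_def k2_def A.inv_mult)
qed

definition linked ::
  "('a, 'n) monoid_scheme
     \<Rightarrow> ('g, 'm) monoid_scheme \<times> 'g set \<times> ('g \<Rightarrow> 'a)
     \<Rightarrow> ('h, 'l) monoid_scheme \<times> 'h set \<times> ('h \<Rightarrow> 'a) \<Rightarrow> bool" where
  "linked A = (\<lambda>(G, K, \<kappa>) (H, L, \<mu>).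
     \<exists>(U, \<phi>) \<in> char_pairs A (G \<times>\<times> H).
       (p1 U, k1 H U, phi1 H U \<phi>) = (carrier G, K, \<kappa>) \<and>
       (p2 U, k2 G U, phi2 A G U \<phi>) = (carrier H, L, \<mu>))"


section \<open>Second cohomology with trivial action\<close>

definition tor :: "('a, 'n) monoid_scheme \<Rightarrow> ('a, 'n) monoid_scheme" where
  "tor A = A\<lparr>carrier := {a \<in> carrier A. \<exists>n::nat. n > 0 \<and> a [^]\<^bsub>A\<^esub> n = \<one>\<^bsub>A\<^esub>}\<rparr>"

text \<open>All functions $Q \times Q \to M$ under pointwise multiplication. Neither cochains nor
  cocycles are required to be normalized.\<close>

definition C2 ::
  "('q, 'm) monoid_scheme \<Rightarrow> ('a, 'n) monoid_scheme \<Rightarrow> ('q \<times> 'q \<Rightarrow> 'a) monoid" where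
  "C2 Q M = product_group (carrier Q \<times> carrier Q) (\<lambda>_. M)"

definition Z2 ::
  "('q, 'm) monoid_scheme \<Rightarrow> ('a, 'n) monoid_scheme \<Rightarrow> ('q \<times> 'q \<Rightarrow> 'a) set" where
  "Z2 Q M = {f \<in> carrier (C2 Q M).
     \<forall>x \<in> carrier Q. \<forall>y \<in> carrier Q. \<forall>z \<in> carrier Q.
       f (x, y) \<otimes>\<^bsub>M\<^esub> f (x \<otimes>\<^bsub>Q\<^esub> y, z) = f (y, z) \<otimes>\<^bsub>M\<^esub> f (x, y \<otimes>\<^bsub>Q\<^esub> z)}"

definition B2 ::
  "('q, 'm) monoid_scheme \<Rightarrow> ('a, 'n) monoid_scheme \<Rightarrow> ('q \<times> 'q \<Rightarrow> 'a) set" where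
  "B2 Q M = {f \<in> carrier (C2 Q M). \<exists>c \<in> carrier Q \<rightarrow> carrier M.
     \<forall>x \<in> carrier Q. \<forall>y \<in> carrier Q. f (x, y) = c x \<otimes>\<^bsub>M\<^esub> c y \<otimes>\<^bsub>M\<^esub> inv\<^bsub>M\<^esub> c (x \<otimes>\<^bsub>Q\<^esub> y)}"

definition H2 ::
  "('q, 'm) monoid_scheme \<Rightarrow> ('a, 'n) monoid_scheme \<Rightarrow> ('q \<times> 'q \<Rightarrow> 'a) set monoid" where
  "H2 Q M = (C2 Q M)\<lparr>carrier := Z2 Q M\<rparr> Mod B2 Q M"

definition H2_class ::
  "('q, 'm) monoid_scheme \<Rightarrow> ('a, 'n) monoid_scheme \<Rightarrow> ('q \<times> 'q \<Rightarrow> 'a) \<Rightarrow> ('q \<times> 'q \<Rightarrow> 'a) set"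
  where "H2_class Q M f = B2 Q M #>\<^bsub>(C2 Q M)\<lparr>carrier := Z2 Q M\<rparr>\<^esub> f"

lemma comm_group_tor:
  assumes "comm_group A" shows "comm_group (tor A)"
proof -
  interpret A: comm_group A by fact
  let ?T = "{a \<in> carrier A. \<exists>n::nat. n > 0 \<and> a [^]\<^bsub>A\<^esub> n = \<one>\<^bsub>A\<^esub>}"
  have "subgroup ?T A"
  proof (rule A.subgroupI)
    have "\<one>\<^bsub>A\<^esub> [^]\<^bsub>A\<^esub> (1::nat) = \<one>\<^bsub>A\<^esub>" by simp
    hence "\<one>\<^bsub>A\<^esub> \<in> ?T" using A.one_closed zero_less_one by blast
    thus "?T \<noteq> {}" by blast
    show "inv\<^bsub>A\<^esub> a \<in> ?T" if a: "a \<in> ?T" for a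
    proof -
      obtain n :: nat where n: "n > 0" "a [^]\<^bsub>A\<^esub> n = \<one>\<^bsub>A\<^esub>" using a by auto
      hence "inv\<^bsub>A\<^esub> a [^]\<^bsub>A\<^esub> n = \<one>\<^bsub>A\<^esub>" using a A.nat_pow_inv[of a n] by simp
      thus ?thesis using n a by auto
    qed
    show "a \<otimes>\<^bsub>A\<^esub> b \<in> ?T" if ab: "a \<in> ?T" "b \<in> ?T" for a b
    proof -
      obtain m n :: nat where mn: "m > 0" "a [^]\<^bsub>A\<^esub> m = \<one>\<^bsub>A\<^esub>" "n > 0" "b [^]\<^bsub>A\<^esub> n = \<one>\<^bsub>A\<^esub>"
        using ab by auto
      have "a [^]\<^bsub>A\<^esub> (m * n) = \<one>\<^bsub>A\<^esub>"
        using mn ab A.nat_pow_pow[of a m n] by simp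
      moreover have "b [^]\<^bsub>A\<^esub> (m * n) = \<one>\<^bsub>A\<^esub>"
        using mn ab A.nat_pow_pow[of b n m] by (simp add: mult.commute)
      ultimately have "(a \<otimes>\<^bsub>A\<^esub> b) [^]\<^bsub>A\<^esub> (m * n) = \<one>\<^bsub>A\<^esub>"
        using ab by (simp add: A.nat_pow_distrib)
      moreover have "m * n > 0" using mn by simp
      ultimately show ?thesis using ab by blast
    qed
  qed auto
  hence "group (tor A)" unfolding tor_def using subgroup.subgroup_is_group A.is_group by blast
  thus ?thesis
    by (rule group.group_comm_groupI) (simp add: tor_def A.m_comm)
qed

lemma group_C2: "group M \<Longrightarrow> group (C2 Q M)"
  unfolding C2_def by simp

lemma subgroup_Z2:
  assumes Q: "group Q" and M: "comm_group M" shows "subgroup (Z2 Q M) (C2 Q M)"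
proof -
  interpret Q: group Q by fact
  interpret M: comm_group M by fact
  interpret C: group "C2 Q M" by (rule group_C2) (rule M.is_group)
  have cl: "f (x, y) \<in> carrier M" if "f \<in> carrier (C2 Q M)" "x \<in> carrier Q" "y \<in> carrier Q" for f x y
    using that by (auto simp: C2_def)
  show ?thesis
  proof (rule C.subgroupI)
    show "Z2 Q M \<subseteq> carrier (C2 Q M)" by (auto simp: Z2_def)
    have "\<one>\<^bsub>C2 Q M\<^esub> \<in> Z2 Q M" by (simp add: Z2_def C2_def)
    thus "Z2 Q M \<noteq> {}" by blast
    show "inv\<^bsub>C2 Q M\<^esub> f \<in> Z2 Q M" if f: "f \<in> Z2 Q M" for f
    proof -
      have fc: "f \<in> carrier (C2 Q M)" using f by (simp add: Z2_def)
      hence v: "inv\<^bsub>C2 Q M\<^esub> f = (\<lambda>p \<in> carrier Q \<times> carrier Q. inv\<^bsub>M\<^esub> f p)"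
        unfolding C2_def by (subst inv_product_group) auto
      show ?thesis
        unfolding Z2_def
      proof (intro CollectI conjI ballI)
        show "inv\<^bsub>C2 Q M\<^esub> f \<in> carrier (C2 Q M)" using fc by simp
      next
        fix x y z assume xyz: "x \<in> carrier Q" "y \<in> carrier Q" "z \<in> carrier Q"
        have "f (x, y) \<otimes>\<^bsub>M\<^esub> f (x \<otimes>\<^bsub>Q\<^esub> y, z) = f (y, z) \<otimes>\<^bsub>M\<^esub> f (x, y \<otimes>\<^bsub>Q\<^esub> z)"
          using f xyz by (simp add: Z2_def)
        thus "(inv\<^bsub>C2 Q M\<^esub> f) (x, y) \<otimes>\<^bsub>M\<^esub> (inv\<^bsub>C2 Q M\<^esub> f) (x \<otimes>\<^bsub>Q\<^esub> y, z) =
          (inv\<^bsub>C2 Q M\<^esub> f) (y, z) \<otimes>\<^bsub>M\<^esub> (inv\<^bsub>C2 Q M\<^esub> f) (x, y \<otimes>\<^bsub>Q\<^esub> z)"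
          using xyz cl[OF fc] by (simp add: v M.inv_mult [symmetric])
      qed
    qed
    show "f \<otimes>\<^bsub>C2 Q M\<^esub> g \<in> Z2 Q M" if f: "f \<in> Z2 Q M" and g: "g \<in> Z2 Q M" for f g
    proof -
      have fc: "f \<in> carrier (C2 Q M)" and gc: "g \<in> carrier (C2 Q M)"
        using f g by (simp_all add: Z2_def)
      show ?thesis
        unfolding Z2_def
      proof (intro CollectI conjI ballI)
        show "f \<otimes>\<^bsub>C2 Q M\<^esub> g \<in> carrier (C2 Q M)" using fc gc by simp
      next
        fix x y z assume xyz: "x \<in> carrier Q" "y \<in> carrier Q" "z \<in> carrier Q"
        have ef: "f (x, y) \<otimes>\<^bsub>M\<^esub> f (x \<otimes>\<^bsub>Q\<^esub> y, z) = f (y, z) \<otimes>\<^bsub>M\<^esub> f (x, y \<otimes>\<^bsub>Q\<^esub> z)"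
          using f xyz by (simp add: Z2_def)
        have eg: "g (x, y) \<otimes>\<^bsub>M\<^esub> g (x \<otimes>\<^bsub>Q\<^esub> y, z) = g (y, z) \<otimes>\<^bsub>M\<^esub> g (x, y \<otimes>\<^bsub>Q\<^esub> z)"
          using g xyz by (simp add: Z2_def)
        have sw: "(a \<otimes>\<^bsub>M\<^esub> b) \<otimes>\<^bsub>M\<^esub> (c \<otimes>\<^bsub>M\<^esub> d) = (a \<otimes>\<^bsub>M\<^esub> c) \<otimes>\<^bsub>M\<^esub> (b \<otimes>\<^bsub>M\<^esub> d)"
          if "a \<in> carrier M" "b \<in> carrier M" "c \<in> carrier M" "d \<in> carrier M" for a b c d
          using that by (simp add: M.m_ac)
        have v: "(f \<otimes>\<^bsub>C2 Q M\<^esub> g) (a, b) = f (a, b) \<otimes>\<^bsub>M\<^esub> g (a, b)"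
          if "a \<in> carrier Q" "b \<in> carrier Q" for a b using that by (simp add: C2_def)
        show "(f \<otimes>\<^bsub>C2 Q M\<^esub> g) (x, y) \<otimes>\<^bsub>M\<^esub> (f \<otimes>\<^bsub>C2 Q M\<^esub> g) (x \<otimes>\<^bsub>Q\<^esub> y, z) =
          (f \<otimes>\<^bsub>C2 Q M\<^esub> g) (y, z) \<otimes>\<^bsub>M\<^esub> (f \<otimes>\<^bsub>C2 Q M\<^esub> g) (x, y \<otimes>\<^bsub>Q\<^esub> z)"
          using sw[of "f (x, y)" "g (x, y)" "f (x \<otimes>\<^bsub>Q\<^esub> y, z)" "g (x \<otimes>\<^bsub>Q\<^esub> y, z)"]
            sw[of "f (y, z)" "g (y, z)" "f (x, y \<otimes>\<^bsub>Q\<^esub> z)" "g (x, y \<otimes>\<^bsub>Q\<^esub> z)"]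
            xyz cl[OF fc] cl[OF gc] by (simp only: v ef eg Q.m_closed)
      qed
    qed
  qed
qed

lemma comm_group_Z2:
  assumes Q: "group Q" and M: "comm_group M" shows "comm_group ((C2 Q M)\<lparr>carrier := Z2 Q M\<rparr>)"
proof -
  interpret M: comm_group M by fact
  interpret Z: group "(C2 Q M)\<lparr>carrier := Z2 Q M\<rparr>"
    using subgroup.subgroup_is_group[OF subgroup_Z2[OF Q M]] group_C2 M.is_group by blast
  show ?thesis
    by (rule Z.group_comm_groupI) (auto simp: Z2_def C2_def PiE_iff intro!: restrict_ext M.m_comm)
qed

lemma subgroup_B2:
  assumes Q: "group Q" and M: "comm_group M"
  shows "subgroup (B2 Q M) ((C2 Q M)\<lparr>carrier := Z2 Q M\<rparr>)"
proof -
  interpret Q: group Q by fact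
  interpret M: comm_group M by fact
  interpret C: group "C2 Q M" by (rule group_C2) (rule M.is_group)
  have sub: "B2 Q M \<subseteq> Z2 Q M"
  proof
    fix f assume f: "f \<in> B2 Q M"
    then obtain c where c: "c \<in> carrier Q \<rightarrow> carrier M"
      and fc: "\<And>x y. x \<in> carrier Q \<Longrightarrow> y \<in> carrier Q \<Longrightarrow>
        f (x, y) = c x \<otimes>\<^bsub>M\<^esub> c y \<otimes>\<^bsub>M\<^esub> inv\<^bsub>M\<^esub> c (x \<otimes>\<^bsub>Q\<^esub> y)"
      by (auto simp: B2_def)
    have cl: "c x \<in> carrier M" if "x \<in> carrier Q" for x using c that by auto
    have key: "(a \<otimes>\<^bsub>M\<^esub> b \<otimes>\<^bsub>M\<^esub> inv\<^bsub>M\<^esub> p) \<otimes>\<^bsub>M\<^esub> (p \<otimes>\<^bsub>M\<^esub> d \<otimes>\<^bsub>M\<^esub> inv\<^bsub>M\<^esub> r) =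
               (b \<otimes>\<^bsub>M\<^esub> d \<otimes>\<^bsub>M\<^esub> inv\<^bsub>M\<^esub> q) \<otimes>\<^bsub>M\<^esub> (a \<otimes>\<^bsub>M\<^esub> q \<otimes>\<^bsub>M\<^esub> inv\<^bsub>M\<^esub> r)"
      if m: "a \<in> carrier M" "b \<in> carrier M" "d \<in> carrier M" "p \<in> carrier M" "q \<in> carrier M"
        "r \<in> carrier M" for a b d p q r
    proof -
      have "(a \<otimes>\<^bsub>M\<^esub> b \<otimes>\<^bsub>M\<^esub> inv\<^bsub>M\<^esub> p) \<otimes>\<^bsub>M\<^esub> (p \<otimes>\<^bsub>M\<^esub> d \<otimes>\<^bsub>M\<^esub> inv\<^bsub>M\<^esub> r) =
        (a \<otimes>\<^bsub>M\<^esub> b \<otimes>\<^bsub>M\<^esub> d \<otimes>\<^bsub>M\<^esub> inv\<^bsub>M\<^esub> r) \<otimes>\<^bsub>M\<^esub> (p \<otimes>\<^bsub>M\<^esub> inv\<^bsub>M\<^esub> p)"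
        using m by (simp only: M.m_ac M.m_closed M.inv_closed)
      moreover have "(b \<otimes>\<^bsub>M\<^esub> d \<otimes>\<^bsub>M\<^esub> inv\<^bsub>M\<^esub> q) \<otimes>\<^bsub>M\<^esub> (a \<otimes>\<^bsub>M\<^esub> q \<otimes>\<^bsub>M\<^esub> inv\<^bsub>M\<^esub> r) =
        (a \<otimes>\<^bsub>M\<^esub> b \<otimes>\<^bsub>M\<^esub> d \<otimes>\<^bsub>M\<^esub> inv\<^bsub>M\<^esub> r) \<otimes>\<^bsub>M\<^esub> (q \<otimes>\<^bsub>M\<^esub> inv\<^bsub>M\<^esub> q)"
        using m by (simp only: M.m_ac M.m_closed M.inv_closed)
      ultimately show ?thesis using m by simp
    qed
    have "f \<in> carrier (C2 Q M)" using f by (simp add: B2_def)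
    moreover have "f (x, y) \<otimes>\<^bsub>M\<^esub> f (x \<otimes>\<^bsub>Q\<^esub> y, z) = f (y, z) \<otimes>\<^bsub>M\<^esub> f (x, y \<otimes>\<^bsub>Q\<^esub> z)"
      if "x \<in> carrier Q" "y \<in> carrier Q" "z \<in> carrier Q" for x y z
      using that key[of "c x" "c y" "c z" "c (x \<otimes>\<^bsub>Q\<^esub> y)" "c (y \<otimes>\<^bsub>Q\<^esub> z)"
          "c (x \<otimes>\<^bsub>Q\<^esub> (y \<otimes>\<^bsub>Q\<^esub> z))"]
      by (simp only: fc cl Q.m_closed Q.m_assoc)
    ultimately show "f \<in> Z2 Q M" by (simp add: Z2_def)
  qed
  have "subgroup (B2 Q M) (C2 Q M)"
  proof (rule C.subgroupI)
    show "B2 Q M \<subseteq> carrier (C2 Q M)" by (auto simp: B2_def)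
    have "\<one>\<^bsub>C2 Q M\<^esub> \<in> B2 Q M"
      by (auto simp: B2_def C2_def intro!: bexI[of _ "\<lambda>_. \<one>\<^bsub>M\<^esub>"])
    thus "B2 Q M \<noteq> {}" by blast
    show "inv\<^bsub>C2 Q M\<^esub> f \<in> B2 Q M" if f: "f \<in> B2 Q M" for f
    proof -
      obtain c where c: "c \<in> carrier Q \<rightarrow> carrier M"
        and e: "\<And>x y. x \<in> carrier Q \<Longrightarrow> y \<in> carrier Q \<Longrightarrow>
          f (x, y) = c x \<otimes>\<^bsub>M\<^esub> c y \<otimes>\<^bsub>M\<^esub> inv\<^bsub>M\<^esub> c (x \<otimes>\<^bsub>Q\<^esub> y)"
        using f by (auto simp: B2_def)
      have cl: "c x \<in> carrier M" if "x \<in> carrier Q" for x using c that by auto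
      have fc: "f \<in> carrier (C2 Q M)" using f by (simp add: B2_def)
      hence v: "inv\<^bsub>C2 Q M\<^esub> f = (\<lambda>p \<in> carrier Q \<times> carrier Q. inv\<^bsub>M\<^esub> f p)"
        unfolding C2_def by (subst inv_product_group) auto
      have "inv\<^bsub>C2 Q M\<^esub> f \<in> carrier (C2 Q M)" using fc by simp
      moreover have "(inv\<^bsub>C2 Q M\<^esub> f) (x, y) =
        inv\<^bsub>M\<^esub> c x \<otimes>\<^bsub>M\<^esub> inv\<^bsub>M\<^esub> c y \<otimes>\<^bsub>M\<^esub> inv\<^bsub>M\<^esub> (inv\<^bsub>M\<^esub> c (x \<otimes>\<^bsub>Q\<^esub> y))"
        if "x \<in> carrier Q" "y \<in> carrier Q" for x y
        using that cl by (simp add: v e M.inv_mult)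
      ultimately show ?thesis
        using cl unfolding B2_def by (auto intro!: bexI[of _ "\<lambda>x. inv\<^bsub>M\<^esub> c x"])
    qed
    show "f \<otimes>\<^bsub>C2 Q M\<^esub> g \<in> B2 Q M" if f: "f \<in> B2 Q M" and g: "g \<in> B2 Q M" for f g
    proof -
      obtain c where c: "c \<in> carrier Q \<rightarrow> carrier M"
        and e: "\<And>x y. x \<in> carrier Q \<Longrightarrow> y \<in> carrier Q \<Longrightarrow>
          f (x, y) = c x \<otimes>\<^bsub>M\<^esub> c y \<otimes>\<^bsub>M\<^esub> inv\<^bsub>M\<^esub> c (x \<otimes>\<^bsub>Q\<^esub> y)"
        using f by (auto simp: B2_def)
      obtain d where d: "d \<in> carrier Q \<rightarrow> carrier M"
        and e': "\<And>x y. x \<in> carrier Q \<Longrightarrow> y \<in> carrier Q \<Longrightarrow>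
          g (x, y) = d x \<otimes>\<^bsub>M\<^esub> d y \<otimes>\<^bsub>M\<^esub> inv\<^bsub>M\<^esub> d (x \<otimes>\<^bsub>Q\<^esub> y)"
        using g by (auto simp: B2_def)
      have cl: "c x \<in> carrier M" "d x \<in> carrier M" if "x \<in> carrier Q" for x using c d that by auto
      have "f \<otimes>\<^bsub>C2 Q M\<^esub> g \<in> carrier (C2 Q M)" using f g by (simp add: B2_def)
      moreover have "(f \<otimes>\<^bsub>C2 Q M\<^esub> g) (x, y) = (c x \<otimes>\<^bsub>M\<^esub> d x) \<otimes>\<^bsub>M\<^esub> (c y \<otimes>\<^bsub>M\<^esub> d y)
         \<otimes>\<^bsub>M\<^esub> inv\<^bsub>M\<^esub> (c (x \<otimes>\<^bsub>Q\<^esub> y) \<otimes>\<^bsub>M\<^esub> d (x \<otimes>\<^bsub>Q\<^esub> y))"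
        if "x \<in> carrier Q" "y \<in> carrier Q" for x y
      proof -
        have "(f \<otimes>\<^bsub>C2 Q M\<^esub> g) (x, y) = f (x, y) \<otimes>\<^bsub>M\<^esub> g (x, y)" using that by (simp add: C2_def)
        thus ?thesis using that cl by (simp add: e e' M.inv_mult M.m_ac)
      qed
      ultimately show ?thesis
        using cl unfolding B2_def by (auto intro!: bexI[of _ "\<lambda>x. c x \<otimes>\<^bsub>M\<^esub> d x"])
    qed
  qed
  thus ?thesis
    using C.subgroup_incl subgroup_Z2[OF Q M] sub by blast
qed

lemma comm_group_H2:
  assumes Q: "group Q" and M: "comm_group M" shows "comm_group (H2 Q M)"
  unfolding H2_def
  using comm_group.abelian_FactGroup[OF comm_group_Z2[OF Q M] subgroup_B2[OF Q M]] .

lemma H2_class_closed: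
  assumes "f \<in> Z2 Q M" shows "H2_class Q M f \<in> carrier (H2 Q M)"
  using assms by (auto simp: H2_class_def H2_def FactGroup_def RCOSETS_def)

definition describes_extension ::
  "('g, 'm) monoid_scheme \<Rightarrow> 'g set \<Rightarrow> ('g set \<times> 'g set \<Rightarrow> 'g) \<Rightarrow> bool" where
  "describes_extension G K \<alpha> \<longleftrightarrow>
     (\<exists>\<sigma> \<in> carrier (G Mod K) \<rightarrow> carrier G.
        (\<forall>x \<in> carrier (G Mod K). K #>\<^bsub>G\<^esub> \<sigma> x = x) \<and>
        (\<forall>x \<in> carrier (G Mod K). \<forall>y \<in> carrier (G Mod K).
           \<sigma> x \<otimes>\<^bsub>G\<^esub> \<sigma> y = \<alpha> (x, y) \<otimes>\<^bsub>G\<^esub> \<sigma> (x \<otimes>\<^bsub>G Mod K\<^esub> y)))"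

text \<open>The functions $\kappa\circ\alpha$ and $\mu\circ\beta\circ(\theta\times\theta)$ are indeed
  cocycles with values in the torsion subgroup of \<open>A\<close>; the second lemma is used with $\theta = \eta^{-1}$.\<close>

lemma char_comp_Z2:
  assumes A: "comm_group A" and G: "group G" and fin: "finite (carrier G)"
    and K: "(K, \<kappa>) \<in> fixed_char_pairs A G" and \<alpha>: "\<alpha> \<in> Z2 (G Mod K) (G\<lparr>carrier := K\<rparr>)"
  shows "restrict (\<kappa> \<circ> \<alpha>) (carrier (G Mod K) \<times> carrier (G Mod K)) \<in> Z2 (G Mod K) (tor A)"
proof -
  interpret A: comm_group A by fact
  interpret G: group G by fact
  have sK: "subgroup K G" and nK: "K \<lhd> G" and hom: "\<kappa> \<in> hom (G\<lparr>carrier := K\<rparr>) A"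
    using K by (auto simp: fixed_char_pairs_def char_pairs_def dual_def)
  interpret GK: group "G\<lparr>carrier := K\<rparr>" using subgroup.subgroup_is_group[OF sK G] .
  interpret \<kappa>: group_hom "G\<lparr>carrier := K\<rparr>" A \<kappa> by unfold_locales (rule hom)
  interpret Q: group "G Mod K" using normal.factorgroup_is_group[OF nK] .
  have finK: "finite K" using fin subgroup.subset[OF sK] finite_subset by blast
  have mult: "\<kappa> (x \<otimes>\<^bsub>G\<^esub> y) = \<kappa> x \<otimes>\<^bsub>A\<^esub> \<kappa> y" if "x \<in> K" "y \<in> K" for x y
    using \<kappa>.hom_mult[of x y] that by simp
  have torsion: "\<kappa> x \<in> carrier (tor A)" if x: "x \<in> K" for x
  proof -
    have o: "x [^]\<^bsub>G\<lparr>carrier := K\<rparr>\<^esub> order (G\<lparr>carrier := K\<rparr>) = \<one>\<^bsub>G\<^esub>"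
      using GK.pow_order_eq_1[of x] x by simp
    have "\<kappa> x [^]\<^bsub>A\<^esub> order (G\<lparr>carrier := K\<rparr>) = \<one>\<^bsub>A\<^esub>"
      using \<kappa>.hom_nat_pow[of x "order (G\<lparr>carrier := K\<rparr>)"] o x \<kappa>.hom_one by simp
    moreover have "order (G\<lparr>carrier := K\<rparr>) > 0" using finK GK.order_gt_0_iff_finite by simp
    moreover have "\<kappa> x \<in> carrier A" using \<kappa>.hom_closed[of x] x by simp
    ultimately show ?thesis by (auto simp: tor_def)
  qed
  have cl: "\<alpha> (x, y) \<in> K" if "x \<in> carrier (G Mod K)" "y \<in> carrier (G Mod K)" for x y
    using \<alpha> that by (auto simp: Z2_def C2_def)
  have coc: "\<kappa> (\<alpha> (x, y)) \<otimes>\<^bsub>A\<^esub> \<kappa> (\<alpha> (x \<otimes>\<^bsub>G Mod K\<^esub> y, z)) =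
             \<kappa> (\<alpha> (y, z)) \<otimes>\<^bsub>A\<^esub> \<kappa> (\<alpha> (x, y \<otimes>\<^bsub>G Mod K\<^esub> z))"
    if "x \<in> carrier (G Mod K)" "y \<in> carrier (G Mod K)" "z \<in> carrier (G Mod K)" for x y z
  proof -
    have "\<alpha> (x, y) \<otimes>\<^bsub>G\<^esub> \<alpha> (x \<otimes>\<^bsub>G Mod K\<^esub> y, z) = \<alpha> (y, z) \<otimes>\<^bsub>G\<^esub> \<alpha> (x, y \<otimes>\<^bsub>G Mod K\<^esub> z)"
      using \<alpha> that by (auto simp: Z2_def)
    thus ?thesis using that cl Q.m_closed by (metis mult)
  qed
  have tm: "a \<otimes>\<^bsub>tor A\<^esub> b = a \<otimes>\<^bsub>A\<^esub> b" for a b by (simp add: tor_def)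
  show ?thesis
    unfolding Z2_def using torsion cl coc Q.m_closed
    by (auto simp: C2_def tm simp del: mult_FactGroup)
qed

lemma pullback_Z2:
  assumes R: "group R" and Q: "group Q" and \<theta>: "\<theta> \<in> hom R Q" and f: "f \<in> Z2 Q M"
  shows "restrict (f \<circ> map_prod \<theta> \<theta>) (carrier R \<times> carrier R) \<in> Z2 R M"
proof -
  interpret R: group R by fact
  interpret \<theta>: group_hom R Q \<theta> using assms by (simp add: group_hom_def group_hom_axioms_def)
  show ?thesis
    using f by (auto simp: Z2_def C2_def)
qed

end

theory Submission
  imports Defs
begin

text \<open>Write \<open>\<mu>\<close> for the character of \<open>L\<close>. Goursat's lemma says that a subgroup \<open>U\<close> of \<open>G \<times> H\<close> with full
  projections and with kernels \<open>K\<close> and \<open>L\<close> is the same thing as an isomorphism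
  \<open>\<eta> : H/L \<rightarrow> G/K\<close>: the subgroup consists of the pairs \<open>(g, h)\<close> whose cosets correspond under \<open>\<eta>\<close>
  (\<open>goursat\<close>, \<open>subgroup_coset_graph\<close>). Linking the two triples therefore means choosing an \<open>\<eta>\<close>
  and a homomorphism \<open>\<phi> : U \<rightarrow> A\<close> that sends \<open>(k, l)\<close> to \<open>\<kappa> k \<cdot> (\<mu> l)\<inverse>\<close> on \<open>K \<times> L\<close>, and the theorem
  reduces to the following claim for a fixed \<open>\<eta>\<close> (\<open>character_on_coset_graph_iff\<close>): such a \<open>\<phi>\<close> exists if and
  only if the two pushed-out cocycles on \<open>G/K\<close> are cohomologous.

  The group \<open>U\<close> is a central extension of \<open>G/K\<close> by \<open>K \<times> L\<close>, where faithfulness of the characters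
  supplies the centrality. If \<open>\<sigma>\<close> and \<open>\<tau>\<close> are sections of the two given extensions, then
  \<open>x \<mapsto> (\<sigma> x, \<tau> (\<eta>\<inverse> x))\<close> is a section of this one, with cocycle \<open>(\<alpha>, \<beta> \<circ> (\<eta>\<inverse> \<times> \<eta>\<inverse>))\<close>. The values
  \<open>c x = \<phi> (\<sigma> x, \<tau> (\<eta>\<inverse> x))\<close> determine \<open>\<phi>\<close>, and \<open>\<phi>\<close> is multiplicative exactly when
  \<open>c x \<cdot> c y = \<kappa> (\<alpha> (x, y)) \<cdot> (\<mu> (\<beta> (\<eta>\<inverse> x, \<eta>\<inverse> y)))\<inverse> \<cdot> c (x y)\<close>, that is, when \<open>c\<close> is a cochain whose
  coboundary is the quotient of the two cocycles. As \<open>U\<close> is finite, \<open>c\<close> has torsion values, so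
  it is a cochain with coefficients in the torsion subgroup and not merely in \<open>A\<close>.\<close>

section \<open>Cohomologous cocycles\<close>

lemma tor_simps:
  "a \<otimes>\<^bsub>tor A\<^esub> b = a \<otimes>\<^bsub>A\<^esub> b" "a \<in> carrier (tor A) \<Longrightarrow> a \<in> carrier A"
  by (auto simp: tor_def)

lemma hom_finite_group_tor:
  assumes A: "group A" and U: "group U" and fin: "finite (carrier U)"
    and \<phi>: "\<phi> \<in> hom U A" and u: "u \<in> carrier U"
  shows "\<phi> u \<in> carrier (tor A)"
proof -
  interpret \<phi>: group_hom U A \<phi>
    using A U \<phi> by (simp add: group_hom_def group_hom_axioms_def)
  have "\<phi> u [^]\<^bsub>A\<^esub> order U = \<one>\<^bsub>A\<^esub>"
    using \<phi>.hom_nat_pow[OF u, of "order U"] \<phi>.G.pow_order_eq_1[OF u] by simp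
  moreover have "order U > 0"
    using fin \<phi>.G.order_gt_0_iff_finite by simp
  ultimately show ?thesis
    using u by (auto simp: tor_def)
qed

text \<open>Equality of classes is equality of cosets of the coboundaries. The relation is written with no
  inverses, so that with coefficients in the torsion subgroup it reads literally as a relation in \<open>A\<close>.\<close>

lemma H2_class_eq_iff:
  assumes Q: "group Q" and M: "comm_group M" and f: "f \<in> Z2 Q M" and g: "g \<in> Z2 Q M"
  shows "H2_class Q M f = H2_class Q M g \<longleftrightarrow>
    (\<exists>c \<in> carrier Q \<rightarrow> carrier M. \<forall>x \<in> carrier Q. \<forall>y \<in> carrier Q.
       f (x, y) \<otimes>\<^bsub>M\<^esub> c (x \<otimes>\<^bsub>Q\<^esub> y) = c x \<otimes>\<^bsub>M\<^esub> c y \<otimes>\<^bsub>M\<^esub> g (x, y))"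
    (is "_ \<longleftrightarrow> ?R")
proof -
  interpret Q: group Q by fact
  interpret M: comm_group M by fact
  let ?Z = "(C2 Q M)\<lparr>carrier := Z2 Q M\<rparr>"
  interpret Z: group ?Z
    using comm_group_Z2[OF Q M] by (simp add: comm_group.axioms)
  have sB: "subgroup (B2 Q M) ?Z" by (rule subgroup_B2[OF Q M])
  have val: "u (x, y) \<in> carrier M"
    if "u \<in> carrier (C2 Q M)" "x \<in> carrier Q" "y \<in> carrier Q" for u x y
    using that by (auto simp: C2_def)
  have fC: "f \<in> carrier (C2 Q M)" and gC: "g \<in> carrier (C2 Q M)"
    using f g by (auto simp: Z2_def)
  have "H2_class Q M f = H2_class Q M g \<longleftrightarrow> f \<in> B2 Q M #>\<^bsub>?Z\<^esub> g"
    unfolding H2_class_def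
    using Z.rcos_self[OF _ sB, of f] Z.repr_independence[OF _ _ sB, of f g] f g by auto
  also have "\<dots> \<longleftrightarrow> (\<exists>b \<in> B2 Q M. f = b \<otimes>\<^bsub>C2 Q M\<^esub> g)"
    by (auto simp: r_coset_def)
  also have "\<dots> \<longleftrightarrow> ?R"
  proof
    assume "\<exists>b \<in> B2 Q M. f = b \<otimes>\<^bsub>C2 Q M\<^esub> g"
    then obtain b where b: "b \<in> B2 Q M" and fb: "f = b \<otimes>\<^bsub>C2 Q M\<^esub> g" by blast
    then obtain c where c: "c \<in> carrier Q \<rightarrow> carrier M"
      and bc: "\<And>x y. x \<in> carrier Q \<Longrightarrow> y \<in> carrier Q \<Longrightarrow>
        b (x, y) = c x \<otimes>\<^bsub>M\<^esub> c y \<otimes>\<^bsub>M\<^esub> inv\<^bsub>M\<^esub> c (x \<otimes>\<^bsub>Q\<^esub> y)"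
      by (auto simp: B2_def)
    have "f (x, y) \<otimes>\<^bsub>M\<^esub> c (x \<otimes>\<^bsub>Q\<^esub> y) = c x \<otimes>\<^bsub>M\<^esub> c y \<otimes>\<^bsub>M\<^esub> g (x, y)"
      if xy: "x \<in> carrier Q" "y \<in> carrier Q" for x y
    proof -
      have cl: "c x \<in> carrier M" "c y \<in> carrier M" "c (x \<otimes>\<^bsub>Q\<^esub> y) \<in> carrier M" "g (x, y) \<in> carrier M"
        using c xy val[OF gC xy] by auto
      have "f (x, y) = c x \<otimes>\<^bsub>M\<^esub> c y \<otimes>\<^bsub>M\<^esub> inv\<^bsub>M\<^esub> c (x \<otimes>\<^bsub>Q\<^esub> y) \<otimes>\<^bsub>M\<^esub> g (x, y)"
        using xy bc by (simp add: fb C2_def)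
      thus ?thesis using cl by (simp add: M.m_ac)
    qed
    thus ?R using c by blast
  next
    assume ?R
    then obtain c where c: "c \<in> carrier Q \<rightarrow> carrier M"
      and fc: "\<And>x y. x \<in> carrier Q \<Longrightarrow> y \<in> carrier Q \<Longrightarrow>
        f (x, y) \<otimes>\<^bsub>M\<^esub> c (x \<otimes>\<^bsub>Q\<^esub> y) = c x \<otimes>\<^bsub>M\<^esub> c y \<otimes>\<^bsub>M\<^esub> g (x, y)"
      by blast
    define b where "b = (\<lambda>(x, y) \<in> carrier Q \<times> carrier Q.
      c x \<otimes>\<^bsub>M\<^esub> c y \<otimes>\<^bsub>M\<^esub> inv\<^bsub>M\<^esub> c (x \<otimes>\<^bsub>Q\<^esub> y))"
    have ccl: "c x \<in> carrier M" if "x \<in> carrier Q" for x using c that by auto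
    have "b \<in> carrier (C2 Q M)"
      using ccl by (auto simp: b_def C2_def)
    hence "b \<in> B2 Q M"
      using c by (auto simp: B2_def b_def)
    moreover have "f = b \<otimes>\<^bsub>C2 Q M\<^esub> g"
    proof
      fix p
      show "f p = (b \<otimes>\<^bsub>C2 Q M\<^esub> g) p"
      proof (cases "p \<in> carrier Q \<times> carrier Q")
        case True
        then obtain x y where p: "p = (x, y)" and xy: "x \<in> carrier Q" "y \<in> carrier Q" by auto
        have cl: "c x \<in> carrier M" "c y \<in> carrier M" "c (x \<otimes>\<^bsub>Q\<^esub> y) \<in> carrier M"
          "g (x, y) \<in> carrier M" "f (x, y) \<in> carrier M"
          using ccl xy val[OF gC xy] val[OF fC xy] by auto
        have "f (x, y) = c x \<otimes>\<^bsub>M\<^esub> c y \<otimes>\<^bsub>M\<^esub> g (x, y) \<otimes>\<^bsub>M\<^esub> inv\<^bsub>M\<^esub> c (x \<otimes>\<^bsub>Q\<^esub> y)"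
          using fc[OF xy] cl M.inv_solve_right[of "f (x, y)" "c x \<otimes>\<^bsub>M\<^esub> c y \<otimes>\<^bsub>M\<^esub> g (x, y)"] by simp
        thus ?thesis
          using cl xy by (simp add: p b_def C2_def M.m_ac)
      next
        case False
        thus ?thesis
          using fC PiE_arb[of f "carrier Q \<times> carrier Q" "\<lambda>_. carrier M" p] by (simp add: C2_def)
      qed
    qed
    ultimately show "\<exists>b \<in> B2 Q M. f = b \<otimes>\<^bsub>C2 Q M\<^esub> g" by blast
  qed
  finally show ?thesis .
qed

section \<open>Goursat's lemma\<close>

text \<open>The fibre product \<open>G \<times>\<^bsub>G/K\<^esub> H\<close> along the canonical projection of \<open>G\<close> and the composite of the
  projection of \<open>H\<close> with \<open>\<eta>\<close>.\<close>

definition coset_graph ::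
  "('g, 'm) monoid_scheme \<Rightarrow> 'g set \<Rightarrow> ('h, 'l) monoid_scheme \<Rightarrow> 'h set \<Rightarrow> ('h set \<Rightarrow> 'g set)
     \<Rightarrow> ('g \<times> 'h) set" where
  "coset_graph G K H L \<eta> =
     {(g, h) \<in> carrier G \<times> carrier H. \<eta> (L #>\<^bsub>H\<^esub> h) = K #>\<^bsub>G\<^esub> g}"

lemma (in normal) rcoset_in_FactGroup: "x \<in> carrier G \<Longrightarrow> H #> x \<in> carrier (G Mod H)"
  by (auto simp: FactGroup_def RCOSETS_def)

lemma (in normal) FactGroup_elem_rcoset:
  "C \<in> carrier (G Mod H) \<Longrightarrow> \<exists>x \<in> carrier G. C = H #> x"
  by (auto simp: FactGroup_def RCOSETS_def)

lemma (in normal) rcoset_eq_iff: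
  assumes "x \<in> carrier G" "y \<in> carrier G"
  shows "H #> x = H #> y \<longleftrightarrow> x \<otimes> inv y \<in> H"
  using assms rcos_module[OF is_group, of y x] rcos_self[OF _ is_subgroup, of x]
    repr_independence[OF _ _ is_subgroup, of x y] by auto

lemma (in normal) rcoset_eq_one_iff:
  assumes "x \<in> carrier G"
  shows "H #> x = H \<longleftrightarrow> x \<in> H"
  using assms coset_join1[OF _ _ is_subgroup] coset_join2[OF _ is_subgroup] subset by auto

lemma subgroup_coset_graph:
  assumes K: "K \<lhd> G" and L: "L \<lhd> H" and \<eta>: "\<eta> \<in> iso (H Mod L) (G Mod K)"
  shows "subgroup (coset_graph G K H L \<eta>) (G \<times>\<times> H)"
    and "p1 (coset_graph G K H L \<eta>) = carrier G" and "p2 (coset_graph G K H L \<eta>) = carrier H"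
    and "k1 H (coset_graph G K H L \<eta>) = K" and "k2 G (coset_graph G K H L \<eta>) = L"
proof -
  interpret K: normal K G by fact
  interpret L: normal L H by fact
  interpret GH: group "G \<times>\<times> H" using DirProd_group[OF K.is_group L.is_group] .
  interpret QG: group "G Mod K" by (rule K.factorgroup_is_group)
  interpret QH: group "H Mod L" by (rule L.factorgroup_is_group)
  interpret \<eta>: group_hom "H Mod L" "G Mod K" \<eta>
    using \<eta> by unfold_locales (simp add: iso_def)
  let ?U = "coset_graph G K H L \<eta>"
  have bij: "bij_betw \<eta> (carrier (H Mod L)) (carrier (G Mod K))"
    using \<eta> by (simp add: iso_def)
  have one: "\<eta> L = K" using \<eta>.hom_one by simp
  have mem: "(g, h) \<in> ?U \<longleftrightarrow> g \<in> carrier G \<and> h \<in> carrier H \<and> \<eta> (L #>\<^bsub>H\<^esub> h) = K #>\<^bsub>G\<^esub> g" for g h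
    by (auto simp: coset_graph_def)
  have m: "(g \<otimes>\<^bsub>G\<^esub> g', h \<otimes>\<^bsub>H\<^esub> h') \<in> ?U" if "(g, h) \<in> ?U" "(g', h') \<in> ?U" for g h g' h'
    using that \<eta>.hom_mult[OF L.rcoset_in_FactGroup L.rcoset_in_FactGroup, of h h']
    by (auto simp: mem K.rcos_sum L.rcos_sum)
  have i: "(inv\<^bsub>G\<^esub> g, inv\<^bsub>H\<^esub> h) \<in> ?U" if gh: "(g, h) \<in> ?U" for g h
  proof -
    have "L #>\<^bsub>H\<^esub> inv\<^bsub>H\<^esub> h = inv\<^bsub>H Mod L\<^esub> (L #>\<^bsub>H\<^esub> h)"
      using gh by (simp add: mem L.inv_FactGroup L.rcoset_in_FactGroup L.rcos_inv)
    moreover have "K #>\<^bsub>G\<^esub> inv\<^bsub>G\<^esub> g = inv\<^bsub>G Mod K\<^esub> (K #>\<^bsub>G\<^esub> g)"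
      using gh by (simp add: mem K.inv_FactGroup K.rcoset_in_FactGroup K.rcos_inv)
    ultimately show ?thesis
      using gh \<eta>.hom_inv[OF L.rcoset_in_FactGroup, of h] by (simp add: mem)
  qed
  have o: "(\<one>\<^bsub>G\<^esub>, \<one>\<^bsub>H\<^esub>) \<in> ?U"
    using one by (simp add: mem K.coset_mult_one L.coset_mult_one K.subset L.subset)
  show "subgroup ?U (G \<times>\<times> H)"
  proof (rule GH.subgroupI)
    show "?U \<subseteq> carrier (G \<times>\<times> H)" by (auto simp: coset_graph_def)
    show "?U \<noteq> {}" using o by blast
    show "inv\<^bsub>G \<times>\<times> H\<^esub> u \<in> ?U" if "u \<in> ?U" for u
      using that i by (cases u) (auto simp: mem inv_DirProd[OF K.is_group L.is_group])
    show "u \<otimes>\<^bsub>G \<times>\<times> H\<^esub> v \<in> ?U" if "u \<in> ?U" "v \<in> ?U" for u v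
      using that m by (cases u; cases v) auto
  qed
  show "p1 ?U = carrier G"
  proof (intro equalityI subsetI)
    show "g \<in> carrier G" if "g \<in> p1 ?U" for g
      using that by (auto simp: p1_def coset_graph_def)
    show "g \<in> p1 ?U" if g: "g \<in> carrier G" for g
    proof -
      obtain Y where Y: "Y \<in> carrier (H Mod L)" "\<eta> Y = K #>\<^bsub>G\<^esub> g"
        using bij K.rcoset_in_FactGroup[OF g] unfolding bij_betw_def by (metis imageE)
      obtain h where "h \<in> carrier H" "Y = L #>\<^bsub>H\<^esub> h"
        using L.FactGroup_elem_rcoset[OF Y(1)] by blast
      hence "(g, h) \<in> ?U" using Y(2) g by (simp add: mem)
      thus ?thesis unfolding p1_def by (rule image_eqI[rotated]) simp
    qed
  qed
  show "p2 ?U = carrier H"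
  proof (intro equalityI subsetI)
    show "h \<in> carrier H" if "h \<in> p2 ?U" for h
      using that by (auto simp: p2_def coset_graph_def)
    show "h \<in> p2 ?U" if h: "h \<in> carrier H" for h
    proof -
      obtain g where "g \<in> carrier G" "\<eta> (L #>\<^bsub>H\<^esub> h) = K #>\<^bsub>G\<^esub> g"
        using K.FactGroup_elem_rcoset[OF \<eta>.hom_closed[OF L.rcoset_in_FactGroup[OF h]]] by blast
      hence "(g, h) \<in> ?U" using h by (simp add: mem)
      thus ?thesis unfolding p2_def by (rule image_eqI[rotated]) simp
    qed
  qed
  have L_one: "L #>\<^bsub>H\<^esub> \<one>\<^bsub>H\<^esub> = L" and K_one: "K #>\<^bsub>G\<^esub> \<one>\<^bsub>G\<^esub> = K"
    using K.subset L.subset by simp_all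
  have "(g, \<one>\<^bsub>H\<^esub>) \<in> ?U \<longleftrightarrow> g \<in> K" for g
    unfolding mem L_one one using K.rcoset_eq_one_iff[of g] K.subset by auto
  thus "k1 H ?U = K" by (simp add: k1_def)
  have "\<eta> (L #>\<^bsub>H\<^esub> h) = K \<longleftrightarrow> h \<in> L" if h: "h \<in> carrier H" for h
  proof -
    have "L \<in> carrier (H Mod L)" using QH.one_closed by simp
    hence "\<eta> (L #>\<^bsub>H\<^esub> h) = \<eta> L \<longleftrightarrow> L #>\<^bsub>H\<^esub> h = L"
      using bij L.rcoset_in_FactGroup[OF h] unfolding bij_betw_def by (metis inj_on_def)
    thus ?thesis using one L.rcoset_eq_one_iff[OF h] by simp
  qed
  hence "(\<one>\<^bsub>G\<^esub>, h) \<in> ?U \<longleftrightarrow> h \<in> L" for h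
    unfolding mem K_one using L.subset by auto
  thus "k2 G ?U = L" by (simp add: k2_def)
qed

text \<open>The fullness of the projections makes \<open>\<eta> (L h) = K g\<close>, for \<open>(g, h) \<in> U\<close>, defined everywhere and
  surjective; the kernel conditions make it well defined and injective, and ensure that \<open>U\<close> contains
  every pair with corresponding cosets.\<close>

lemma goursat:
  assumes K: "K \<lhd> G" and L: "L \<lhd> H" and U: "subgroup U (G \<times>\<times> H)"
    and p: "p1 U = carrier G" "p2 U = carrier H" and k: "k1 H U = K" "k2 G U = L"
  shows "\<exists>\<eta> \<in> iso (H Mod L) (G Mod K). U = coset_graph G K H L \<eta>"
proof -
  interpret K: normal K G by fact
  interpret L: normal L H by fact
  have car: "g \<in> carrier G" "h \<in> carrier H" if "(g, h) \<in> U" for g h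
    using subgroup.subset[OF U] that by auto
  have m: "(g \<otimes>\<^bsub>G\<^esub> g', h \<otimes>\<^bsub>H\<^esub> h') \<in> U" if "(g, h) \<in> U" "(g', h') \<in> U" for g h g' h'
    using subgroup.m_closed[OF U that] by simp
  have i: "(inv\<^bsub>G\<^esub> g, inv\<^bsub>H\<^esub> h) \<in> U" if "(g, h) \<in> U" for g h
    using subgroup.m_inv_closed[OF U that] car[OF that]
    by (simp add: inv_DirProd[OF K.is_group L.is_group])
  have kK: "(g, \<one>\<^bsub>H\<^esub>) \<in> U \<longleftrightarrow> g \<in> K" for g using k by (auto simp: k1_def)
  have kL: "(\<one>\<^bsub>G\<^esub>, h) \<in> U \<longleftrightarrow> h \<in> L" for h using k by (auto simp: k2_def)
  have kKL: "g \<in> K \<longleftrightarrow> h \<in> L" if gh: "(g, h) \<in> U" for g h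
  proof
    assume "g \<in> K"
    hence "(inv\<^bsub>G\<^esub> g, \<one>\<^bsub>H\<^esub>) \<in> U" using kK by simp
    from m[OF this gh] show "h \<in> L" using car[OF gh] kL by simp
  next
    assume "h \<in> L"
    hence "(\<one>\<^bsub>G\<^esub>, inv\<^bsub>H\<^esub> h) \<in> U" using kL by simp
    from m[OF this gh] show "g \<in> K" using car[OF gh] kK by simp
  qed
  \<comment> \<open>Applied to the quotient of two elements of \<open>U\<close>, this gives well-definedness and injectivity of
    \<open>\<eta>\<close> at once.\<close>
  have same: "K #>\<^bsub>G\<^esub> g = K #>\<^bsub>G\<^esub> g' \<longleftrightarrow> L #>\<^bsub>H\<^esub> h = L #>\<^bsub>H\<^esub> h'"
    if "(g, h) \<in> U" "(g', h') \<in> U" for g h g' h'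
    using kKL[OF m[OF that(1) i[OF that(2)]]] car[OF that(1)] car[OF that(2)]
    by (simp add: K.rcoset_eq_iff L.rcoset_eq_iff)
  have exg: "\<exists>g. (g, h) \<in> U" if "h \<in> carrier H" for h
    using p(2) that by (force simp: p2_def)
  have exh: "\<exists>h. (g, h) \<in> U" if "g \<in> carrier G" for g
    using p(1) that by (force simp: p1_def)
  define \<eta> where "\<eta> = (\<lambda>Y. THE C. \<exists>(g, h) \<in> U. Y = L #>\<^bsub>H\<^esub> h \<and> C = K #>\<^bsub>G\<^esub> g)"
  have \<eta>: "\<eta> (L #>\<^bsub>H\<^esub> h) = K #>\<^bsub>G\<^esub> g" if "(g, h) \<in> U" for g h
    unfolding \<eta>_def by (rule the_equality) (use that same in blast)+
  have mem: "(g, h) \<in> U \<longleftrightarrow> g \<in> carrier G \<and> h \<in> carrier H \<and> \<eta> (L #>\<^bsub>H\<^esub> h) = K #>\<^bsub>G\<^esub> g" for g h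
  proof
    assume *: "g \<in> carrier G \<and> h \<in> carrier H \<and> \<eta> (L #>\<^bsub>H\<^esub> h) = K #>\<^bsub>G\<^esub> g"
    then obtain g' where g': "(g', h) \<in> U" using exg by blast
    hence "g \<otimes>\<^bsub>G\<^esub> inv\<^bsub>G\<^esub> g' \<in> K"
      using * \<eta>[OF g'] car[OF g'] by (simp add: K.rcoset_eq_iff[symmetric])
    hence "(g \<otimes>\<^bsub>G\<^esub> inv\<^bsub>G\<^esub> g', \<one>\<^bsub>H\<^esub>) \<in> U" using kK by simp
    from m[OF this g'] show "(g, h) \<in> U"
      using * car[OF g'] by (simp add: K.m_assoc)
  qed (use car \<eta> in auto)
  have "\<eta> \<in> hom (H Mod L) (G Mod K)"
  proof (rule homI)
    fix Y assume "Y \<in> carrier (H Mod L)"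
    then obtain h where h: "h \<in> carrier H" "Y = L #>\<^bsub>H\<^esub> h" using L.FactGroup_elem_rcoset by blast
    then obtain g where "(g, h) \<in> U" using exg by blast
    thus "\<eta> Y \<in> carrier (G Mod K)" using \<eta> h car K.rcoset_in_FactGroup by simp
  next
    fix Y Y' assume "Y \<in> carrier (H Mod L)" "Y' \<in> carrier (H Mod L)"
    then obtain h h' where h: "h \<in> carrier H" "Y = L #>\<^bsub>H\<^esub> h" "h' \<in> carrier H" "Y' = L #>\<^bsub>H\<^esub> h'"
      using L.FactGroup_elem_rcoset by meson
    then obtain g g' where "(g, h) \<in> U" "(g', h') \<in> U" using exg by blast
    thus "\<eta> (Y \<otimes>\<^bsub>H Mod L\<^esub> Y') = \<eta> Y \<otimes>\<^bsub>G Mod K\<^esub> \<eta> Y'"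
      using \<eta> m h car by (simp add: K.rcos_sum L.rcos_sum)
  qed
  moreover have "bij_betw \<eta> (carrier (H Mod L)) (carrier (G Mod K))"
  proof (rule bij_betw_imageI)
    show "inj_on \<eta> (carrier (H Mod L))"
    proof (rule inj_onI)
      fix Y Y' assume "Y \<in> carrier (H Mod L)" "Y' \<in> carrier (H Mod L)" and e: "\<eta> Y = \<eta> Y'"
      then obtain h h' where h: "h \<in> carrier H" "Y = L #>\<^bsub>H\<^esub> h" "h' \<in> carrier H" "Y' = L #>\<^bsub>H\<^esub> h'"
        using L.FactGroup_elem_rcoset by meson
      then obtain g g' where "(g, h) \<in> U" "(g', h') \<in> U" using exg by blast
      thus "Y = Y'" using e \<eta> h same by simp
    qed
    have "C \<in> \<eta> ` carrier (H Mod L)" if C: "C \<in> carrier (G Mod K)" for C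
    proof -
      obtain g where g: "g \<in> carrier G" "C = K #>\<^bsub>G\<^esub> g" using K.FactGroup_elem_rcoset[OF C] by blast
      then obtain h where "(g, h) \<in> U" using exh by blast
      thus ?thesis using \<eta> g car L.rcoset_in_FactGroup by (auto intro!: image_eqI)
    qed
    thus "\<eta> ` carrier (H Mod L) = carrier (G Mod K)"
      using \<open>\<eta> \<in> hom (H Mod L) (G Mod K)\<close> by (auto simp: hom_def)
  qed
  moreover have "U = coset_graph G K H L \<eta>"
    using mem by (auto simp: coset_graph_def)
  ultimately show ?thesis by (auto simp: iso_def)
qed

section \<open>Coordinates on a central extension\<close>

text \<open>The map \<open>\<sigma>\<close> may send the trivial coset to any element of \<open>K\<close>, so \<open>\<alpha>\<close> may be
  non-normalized. Where the identity of \<open>G\<close> is written in terms of \<open>\<sigma>\<close>, a correction factor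
  from \<open>K\<close> appears.\<close>

locale central_section = normal K G for K and G (structure) +
  fixes \<sigma> :: "'a set \<Rightarrow> 'a" and \<alpha> :: "'a set \<times> 'a set \<Rightarrow> 'a"
  assumes central: "\<lbrakk>k \<in> K; g \<in> carrier G\<rbrakk> \<Longrightarrow> g \<otimes> k = k \<otimes> g"
    and lift_closed [simp]: "C \<in> carrier (G Mod K) \<Longrightarrow> \<sigma> C \<in> carrier G"
    and rcoset_lift [simp]: "C \<in> carrier (G Mod K) \<Longrightarrow> K #> \<sigma> C = C"
    and cocycle_closed [simp]:
      "\<lbrakk>C \<in> carrier (G Mod K); Y \<in> carrier (G Mod K)\<rbrakk> \<Longrightarrow> \<alpha> (C, Y) \<in> K"
    and lift_mult:
      "\<lbrakk>C \<in> carrier (G Mod K); Y \<in> carrier (G Mod K)\<rbrakk> \<Longrightarrow>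
         \<sigma> C \<otimes> \<sigma> Y = \<alpha> (C, Y) \<otimes> \<sigma> (C \<otimes>\<^bsub>G Mod K\<^esub> Y)"
begin

text \<open>Every \<open>g\<close> is uniquely \<open>k \<cdot> \<sigma> C\<close> with \<open>k \<in> K\<close> and \<open>C\<close> a coset; this is the coordinate \<open>k\<close>.\<close>

definition kernel_part :: "'a \<Rightarrow> 'a" where
  "kernel_part g = g \<otimes> inv \<sigma> (K #> g)"

lemma kernel_part_closed [simp]:
  assumes g: "g \<in> carrier G" shows "kernel_part g \<in> K"
  using rcoset_eq_iff[of g "\<sigma> (K #> g)"] g rcoset_in_FactGroup[OF g]
  by (simp add: kernel_part_def)

lemma kernel_part_mult_lift:
  "g \<in> carrier G \<Longrightarrow> kernel_part g \<otimes> \<sigma> (K #> g) = g"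
  by (simp add: kernel_part_def rcoset_in_FactGroup m_assoc)

lemma rcoset_mult_kernel:
  assumes "k \<in> K" "g \<in> carrier G" shows "K #> (k \<otimes> g) = K #> g"
  using assms by (simp add: coset_mult_assoc[symmetric] subset rcos_const[OF is_group])

lemma kernel_part_unique:
  assumes "k \<in> K" "C \<in> carrier (G Mod K)" shows "kernel_part (k \<otimes> \<sigma> C) = k"
  using assms by (simp add: kernel_part_def rcoset_mult_kernel m_assoc)

lemma kernel_part_kernel_mult:
  assumes "k \<in> K" "g \<in> carrier G" shows "kernel_part (k \<otimes> g) = k \<otimes> kernel_part g"
  using assms by (simp add: kernel_part_def rcoset_mult_kernel rcoset_in_FactGroup m_assoc)

text \<open>Centrality of \<open>K\<close> allows the factors from \<open>K\<close> to be collected on the left, after which the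
  product of the two lifts contributes the value of the cocycle.\<close>

lemma kernel_part_mult:
  assumes g: "g \<in> carrier G" and h: "h \<in> carrier G"
  shows "kernel_part (g \<otimes> h) = kernel_part g \<otimes> kernel_part h \<otimes> \<alpha> (K #> g, K #> h)"
proof -
  interpret Q: group "G Mod K" by (rule factorgroup_is_group)
  let ?C = "K #> g" and ?Y = "K #> h" and ?k = "kernel_part g" and ?l = "kernel_part h"
  have C: "?C \<in> carrier (G Mod K)" and Y: "?Y \<in> carrier (G Mod K)"
    using g h by (simp_all only: rcoset_in_FactGroup)
  have XY: "?C \<otimes>\<^bsub>G Mod K\<^esub> ?Y \<in> carrier (G Mod K)" using C Y by (rule Q.m_closed)
  have k: "?k \<in> K" and l: "?l \<in> K" using g h by simp_all
  have a: "\<alpha> (?C, ?Y) \<in> K" using C Y by simp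
  have "g \<otimes> h = (?k \<otimes> \<sigma> ?C) \<otimes> (?l \<otimes> \<sigma> ?Y)"
    using g h by (simp add: kernel_part_mult_lift)
  also have "\<dots> = ?k \<otimes> (\<sigma> ?C \<otimes> ?l) \<otimes> \<sigma> ?Y"
    using k l C Y by (simp add: m_assoc)
  also have "\<dots> = ?k \<otimes> ?l \<otimes> (\<sigma> ?C \<otimes> \<sigma> ?Y)"
    using k l C Y by (simp add: central m_assoc)
  also have "\<dots> = (?k \<otimes> ?l \<otimes> \<alpha> (?C, ?Y)) \<otimes> \<sigma> (?C \<otimes>\<^bsub>G Mod K\<^esub> ?Y)"
    using k l a C Y XY by (simp add: lift_mult m_assoc del: mult_FactGroup)
  finally show ?thesis
    using k l a XY by (simp add: kernel_part_unique del: mult_FactGroup)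
qed

end

text \<open>Conjugation by \<open>g\<close> preserves the character \<open>\<kappa>\<close>, and a faithful character separates the elements of
  \<open>K\<close>, so conjugation fixes \<open>K\<close> pointwise.\<close>

lemma central_section_exists:
  assumes G: "group G" and K: "(K, \<kappa>) \<in> fixed_char_pairs A G" and inj: "inj_on \<kappa> K"
    and \<alpha>: "\<alpha> \<in> Z2 (G Mod K) (G\<lparr>carrier := K\<rparr>)" and ext: "describes_extension G K \<alpha>"
  shows "\<exists>\<sigma>. central_section K G \<sigma> \<alpha>"
proof -
  have nK: "K \<lhd> G" and invariant: "\<And>g x. g \<in> carrier G \<Longrightarrow> x \<in> K \<Longrightarrow>
      \<kappa> (g \<otimes>\<^bsub>G\<^esub> x \<otimes>\<^bsub>G\<^esub> inv\<^bsub>G\<^esub> g) = \<kappa> x"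
    using K by (auto simp: fixed_char_pairs_def)
  interpret normal K G by (rule nK)
  have central: "g \<otimes>\<^bsub>G\<^esub> k = k \<otimes>\<^bsub>G\<^esub> g" if k: "k \<in> K" and g: "g \<in> carrier G" for k g
  proof -
    have "g \<otimes>\<^bsub>G\<^esub> k \<otimes>\<^bsub>G\<^esub> inv\<^bsub>G\<^esub> g = k"
      using inj_onD[OF inj invariant[OF g k]] inv_op_closed2[OF g k] k by blast
    thus ?thesis using g k inv_solve_right'[of k "g \<otimes>\<^bsub>G\<^esub> k" g] by simp
  qed
  obtain \<sigma> where "\<sigma> \<in> carrier (G Mod K) \<rightarrow> carrier G"
    and "\<forall>x \<in> carrier (G Mod K). K #>\<^bsub>G\<^esub> \<sigma> x = x"
    and "\<forall>x \<in> carrier (G Mod K). \<forall>y \<in> carrier (G Mod K).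
           \<sigma> x \<otimes>\<^bsub>G\<^esub> \<sigma> y = \<alpha> (x, y) \<otimes>\<^bsub>G\<^esub> \<sigma> (x \<otimes>\<^bsub>G Mod K\<^esub> y)"
    using ext by (auto simp: describes_extension_def)
  moreover have "\<alpha> (x, y) \<in> K" if "x \<in> carrier (G Mod K)" "y \<in> carrier (G Mod K)" for x y
    using \<alpha> that by (auto simp: Z2_def C2_def)
  ultimately have "central_section K G \<sigma> \<alpha>"
    using central by unfold_locales auto
  thus ?thesis by blast
qed

section \<open>Characters on the fibre product\<close>

lemma linked_iff_coset_graph:
  assumes K: "K \<lhd> G" and L: "L \<lhd> H"
  shows "linked A (G, K, \<kappa>) (H, L, \<mu>) \<longleftrightarrow>
    (\<exists>\<eta> \<in> iso (H Mod L) (G Mod K).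
       \<exists>\<phi> \<in> dual A ((G \<times>\<times> H)\<lparr>carrier := coset_graph G K H L \<eta>\<rparr>).
         phi1 H (coset_graph G K H L \<eta>) \<phi> = \<kappa> \<and> phi2 A G (coset_graph G K H L \<eta>) \<phi> = \<mu>)"
    (is "?linked \<longleftrightarrow> ?graph")
proof
  assume ?linked
  then obtain U \<phi> where U: "subgroup U (G \<times>\<times> H)" and \<phi>: "\<phi> \<in> dual A ((G \<times>\<times> H)\<lparr>carrier := U\<rparr>)"
    and p: "p1 U = carrier G" "p2 U = carrier H" and k: "k1 H U = K" "k2 G U = L"
    and res: "phi1 H U \<phi> = \<kappa>" "phi2 A G U \<phi> = \<mu>"
    by (auto simp: linked_def char_pairs_def)
  obtain \<eta> where "\<eta> \<in> iso (H Mod L) (G Mod K)" and "U = coset_graph G K H L \<eta>"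
    using goursat[OF K L U p k] by blast
  thus ?graph using \<phi> res by blast
next
  assume ?graph
  then obtain \<eta> \<phi> where \<eta>: "\<eta> \<in> iso (H Mod L) (G Mod K)"
    and "\<phi> \<in> dual A ((G \<times>\<times> H)\<lparr>carrier := coset_graph G K H L \<eta>\<rparr>)"
    and "phi1 H (coset_graph G K H L \<eta>) \<phi> = \<kappa>" "phi2 A G (coset_graph G K H L \<eta>) \<phi> = \<mu>"
    by blast
  hence "(coset_graph G K H L \<eta>, \<phi>) \<in> char_pairs A (G \<times>\<times> H)"
    and "phi1 H (coset_graph G K H L \<eta>) \<phi> = \<kappa>" "phi2 A G (coset_graph G K H L \<eta>) \<phi> = \<mu>"
    using subgroup_coset_graph(1)[OF K L \<eta>] by (simp_all add: char_pairs_def)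
  thus ?linked
    using subgroup_coset_graph(2-)[OF K L \<eta>]
    by (auto simp: linked_def intro!: bexI[of _ "(coset_graph G K H L \<eta>, \<phi>)"])
qed

text \<open>The correspondence between characters \<open>\<phi>\<close> of the fibre product and cochains \<open>c\<close> is evaluation on
  the section \<open>x \<mapsto> (\<sigma> x, \<tau> (\<eta>' x))\<close> in one direction; in the other it is the formula
  \<open>\<phi> (k \<cdot> \<sigma> x, l \<cdot> \<tau> (\<eta>' x)) = \<kappa> k \<cdot> (\<mu> l)\<inverse> \<cdot> c x\<close>. Finiteness of \<open>G\<close> and \<open>H\<close> makes the values of \<open>c\<close>
  torsion elements.\<close>

lemma character_on_coset_graph_iff:
  assumes A: "comm_group A" and finG: "finite (carrier G)" and finH: "finite (carrier H)"
    and G: "central_section K G \<sigma> \<alpha>" and H: "central_section L H \<tau> \<beta>"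
    and \<kappa>: "\<kappa> \<in> dual A (G\<lparr>carrier := K\<rparr>)" and \<mu>: "\<mu> \<in> dual A (H\<lparr>carrier := L\<rparr>)"
    and \<eta>: "\<eta> \<in> iso (H Mod L) (G Mod K)"
  defines "U \<equiv> coset_graph G K H L \<eta>" and "\<eta>' \<equiv> inv_into (carrier (H Mod L)) \<eta>"
  shows "(\<exists>\<phi> \<in> dual A ((G \<times>\<times> H)\<lparr>carrier := U\<rparr>). phi1 H U \<phi> = \<kappa> \<and> phi2 A G U \<phi> = \<mu>) \<longleftrightarrow>
    (\<exists>c \<in> carrier (G Mod K) \<rightarrow> carrier (tor A).
       \<forall>x \<in> carrier (G Mod K). \<forall>y \<in> carrier (G Mod K).
         \<kappa> (\<alpha> (x, y)) \<otimes>\<^bsub>A\<^esub> c (x \<otimes>\<^bsub>G Mod K\<^esub> y) = c x \<otimes>\<^bsub>A\<^esub> c y \<otimes>\<^bsub>A\<^esub> \<mu> (\<beta> (\<eta>' x, \<eta>' y)))"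
    (is "?character \<longleftrightarrow> ?cochain")
proof -
  interpret A: comm_group A by fact
  interpret G: central_section K G \<sigma> \<alpha> by fact
  interpret H: central_section L H \<tau> \<beta> by fact
  interpret GH: group "G \<times>\<times> H" using DirProd_group[OF G.is_group H.is_group] .
  interpret QG: group "G Mod K" by (rule G.factorgroup_is_group)
  interpret QH: group "H Mod L" by (rule H.factorgroup_is_group)
  note U = subgroup_coset_graph[OF G.normal_axioms H.normal_axioms \<eta>, folded U_def]
  have sub: "U \<subseteq> carrier G \<times> carrier H" by (auto simp: U_def coset_graph_def)
  have mU: "(g \<otimes>\<^bsub>G\<^esub> g', h \<otimes>\<^bsub>H\<^esub> h') \<in> U" if "(g, h) \<in> U" "(g', h') \<in> U" for g h g' h'
    using subgroup.m_closed[OF U(1) that] by simp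
  have KU: "(k, \<one>\<^bsub>H\<^esub>) \<in> U" if "k \<in> K" for k using U(4) that by (auto simp: k1_def)
  have LU: "(\<one>\<^bsub>G\<^esub>, l) \<in> U" if "l \<in> L" for l using U(5) that by (auto simp: k2_def)
  have bij: "bij_betw \<eta> (carrier (H Mod L)) (carrier (G Mod K))"
    using \<eta> by (simp add: iso_def)
  have \<eta>'_iso: "\<eta>' \<in> iso (G Mod K) (H Mod L)"
    unfolding \<eta>'_def by (rule QH.iso_set_sym[OF \<eta>])
  have \<eta>'_closed: "\<eta>' x \<in> carrier (H Mod L)" if "x \<in> carrier (G Mod K)" for x
    using \<eta>'_iso that by (auto simp: iso_def hom_def)
  have \<eta>'_mult: "\<eta>' (x \<otimes>\<^bsub>G Mod K\<^esub> y) = \<eta>' x \<otimes>\<^bsub>H Mod L\<^esub> \<eta>' y"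
    if "x \<in> carrier (G Mod K)" "y \<in> carrier (G Mod K)" for x y
    using \<eta>'_iso that by (simp add: iso_def hom_mult del: mult_FactGroup)
  have \<eta>\<eta>': "\<eta> (\<eta>' x) = x" if "x \<in> carrier (G Mod K)" for x
    using bij_betw_inv_into_right[OF bij that] by (simp add: \<eta>'_def)
  have \<eta>'_coset: "\<eta>' (K #>\<^bsub>G\<^esub> g) = L #>\<^bsub>H\<^esub> h" if "(g, h) \<in> U" for g h
  proof -
    have "h \<in> carrier H" "\<eta> (L #>\<^bsub>H\<^esub> h) = K #>\<^bsub>G\<^esub> g"
      using that by (auto simp: U_def coset_graph_def)
    thus ?thesis
      using bij_betw_inv_into_left[OF bij H.rcoset_in_FactGroup, of h] by (simp add: \<eta>'_def)
  qed
  have lift_U: "(\<sigma> x, \<tau> (\<eta>' x)) \<in> U" if "x \<in> carrier (G Mod K)" for x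
    using that \<eta>'_closed[OF that] \<eta>\<eta>'[OF that] by (simp add: U_def coset_graph_def)
  have \<kappa>_cl: "\<kappa> k \<in> carrier A" if "k \<in> K" for k using \<kappa> that by (auto simp: dual_def hom_def)
  have \<mu>_cl: "\<mu> l \<in> carrier A" if "l \<in> L" for l using \<mu> that by (auto simp: dual_def hom_def)
  have \<kappa>_mult: "\<kappa> (k \<otimes>\<^bsub>G\<^esub> k') = \<kappa> k \<otimes>\<^bsub>A\<^esub> \<kappa> k'" if "k \<in> K" "k' \<in> K" for k k'
    using \<kappa> that by (auto simp: dual_def hom_def)
  have \<mu>_mult: "\<mu> (l \<otimes>\<^bsub>H\<^esub> l') = \<mu> l \<otimes>\<^bsub>A\<^esub> \<mu> l'" if "l \<in> L" "l' \<in> L" for l l'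
    using \<mu> that by (auto simp: dual_def hom_def)
  show ?thesis
  proof
    assume ?character
    then obtain \<phi> where \<phi>: "\<phi> \<in> hom ((G \<times>\<times> H)\<lparr>carrier := U\<rparr>) A"
      and \<phi>1: "phi1 H U \<phi> = \<kappa>" and \<phi>2: "phi2 A G U \<phi> = \<mu>"
      by (auto simp: dual_def)
    have \<phi>_cl: "\<phi> u \<in> carrier A" if "u \<in> U" for u using \<phi> that by (auto simp: hom_def)
    have \<phi>_mult: "\<phi> (g \<otimes>\<^bsub>G\<^esub> g', h \<otimes>\<^bsub>H\<^esub> h') = \<phi> (g, h) \<otimes>\<^bsub>A\<^esub> \<phi> (g', h')"
      if "(g, h) \<in> U" "(g', h') \<in> U" for g h g' h'
      using hom_mult[OF \<phi>, of "(g, h)" "(g', h')"] that by simp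
    have \<phi>K: "\<phi> (k, \<one>\<^bsub>H\<^esub>) = \<kappa> k" if "k \<in> K" for k
      using fun_cong[OF \<phi>1, of k] U(4) that by (simp add: phi1_def)
    have \<phi>L: "\<phi> (\<one>\<^bsub>G\<^esub>, l) = inv\<^bsub>A\<^esub> \<mu> l" if "l \<in> L" for l
      using fun_cong[OF \<phi>2, of l, symmetric] U(5) \<phi>_cl[OF LU[OF that]] that
      by (simp add: phi2_def)
    have \<phi>KL: "\<phi> (k \<otimes>\<^bsub>G\<^esub> g, l \<otimes>\<^bsub>H\<^esub> h) = \<kappa> k \<otimes>\<^bsub>A\<^esub> inv\<^bsub>A\<^esub> \<mu> l \<otimes>\<^bsub>A\<^esub> \<phi> (g, h)"
      if k: "k \<in> K" and l: "l \<in> L" and gh: "(g, h) \<in> U" for k l g h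
    proof -
      have "\<phi> (k, l) = \<kappa> k \<otimes>\<^bsub>A\<^esub> inv\<^bsub>A\<^esub> \<mu> l"
        using \<phi>_mult[OF KU[OF k] LU[OF l]] k l by (simp add: \<phi>K \<phi>L)
      moreover have "(k, l) \<in> U"
        using mU[OF KU[OF k] LU[OF l]] k l by simp
      ultimately show ?thesis using \<phi>_mult[of k l g h] gh by simp
    qed
    define c where "c = (\<lambda>x. \<phi> (\<sigma> x, \<tau> (\<eta>' x)))"
    have c_tor: "c x \<in> carrier (tor A)" if "x \<in> carrier (G Mod K)" for x
      unfolding c_def
    proof (rule hom_finite_group_tor[OF A.is_group _ _ \<phi>])
      show "group ((G \<times>\<times> H)\<lparr>carrier := U\<rparr>)"
        using subgroup.subgroup_is_group[OF U(1) GH.is_group] .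
      show "finite (carrier ((G \<times>\<times> H)\<lparr>carrier := U\<rparr>))"
        using finite_subset[OF sub] finG finH by simp
    qed (simp add: lift_U[OF that])
    have "\<kappa> (\<alpha> (x, y)) \<otimes>\<^bsub>A\<^esub> c (x \<otimes>\<^bsub>G Mod K\<^esub> y) = c x \<otimes>\<^bsub>A\<^esub> c y \<otimes>\<^bsub>A\<^esub> \<mu> (\<beta> (\<eta>' x, \<eta>' y))"
      if x: "x \<in> carrier (G Mod K)" and y: "y \<in> carrier (G Mod K)" for x y
    proof -
      let ?xy = "x \<otimes>\<^bsub>G Mod K\<^esub> y" and ?a = "\<alpha> (x, y)" and ?b = "\<beta> (\<eta>' x, \<eta>' y)"
      have xy: "?xy \<in> carrier (G Mod K)" using x y by (rule QG.m_closed)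
      have a: "?a \<in> K" and b: "?b \<in> L" using x y \<eta>'_closed by simp_all
      have cl: "c x \<in> carrier A" "c y \<in> carrier A" "c ?xy \<in> carrier A" "\<kappa> ?a \<in> carrier A" "\<mu> ?b \<in> carrier A"
        by (simp_all only: tor_simps(2)[OF c_tor] x y xy \<kappa>_cl[OF a] \<mu>_cl[OF b])
      have "c x \<otimes>\<^bsub>A\<^esub> c y = \<phi> (\<sigma> x \<otimes>\<^bsub>G\<^esub> \<sigma> y, \<tau> (\<eta>' x) \<otimes>\<^bsub>H\<^esub> \<tau> (\<eta>' y))"
        using \<phi>_mult[OF lift_U[OF x] lift_U[OF y]] by (simp add: c_def)
      also have "\<dots> = \<phi> (?a \<otimes>\<^bsub>G\<^esub> \<sigma> ?xy, ?b \<otimes>\<^bsub>H\<^esub> \<tau> (\<eta>' ?xy))"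
        by (simp only: G.lift_mult[OF x y] H.lift_mult[OF \<eta>'_closed[OF x] \<eta>'_closed[OF y]] \<eta>'_mult[OF x y])
      also have "\<dots> = \<kappa> ?a \<otimes>\<^bsub>A\<^esub> inv\<^bsub>A\<^esub> \<mu> ?b \<otimes>\<^bsub>A\<^esub> c ?xy"
        using \<phi>KL[OF a b lift_U[OF xy]] by (simp only: c_def)
      finally have "c x \<otimes>\<^bsub>A\<^esub> c y \<otimes>\<^bsub>A\<^esub> \<mu> ?b = \<kappa> ?a \<otimes>\<^bsub>A\<^esub> inv\<^bsub>A\<^esub> \<mu> ?b \<otimes>\<^bsub>A\<^esub> c ?xy \<otimes>\<^bsub>A\<^esub> \<mu> ?b"
        by (simp only:)
      also have "\<dots> = \<kappa> ?a \<otimes>\<^bsub>A\<^esub> c ?xy \<otimes>\<^bsub>A\<^esub> (inv\<^bsub>A\<^esub> \<mu> ?b \<otimes>\<^bsub>A\<^esub> \<mu> ?b)"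
        using cl by (simp only: A.m_ac A.m_closed A.inv_closed)
      finally show ?thesis
        using cl by (simp del: mult_FactGroup)
    qed
    thus ?cochain using c_tor by blast
  next
    assume ?cochain
    then obtain c where c: "c \<in> carrier (G Mod K) \<rightarrow> carrier (tor A)"
      and coboundary: "\<forall>x \<in> carrier (G Mod K). \<forall>y \<in> carrier (G Mod K).
         \<kappa> (\<alpha> (x, y)) \<otimes>\<^bsub>A\<^esub> c (x \<otimes>\<^bsub>G Mod K\<^esub> y) = c x \<otimes>\<^bsub>A\<^esub> c y \<otimes>\<^bsub>A\<^esub> \<mu> (\<beta> (\<eta>' x, \<eta>' y))"
      by (rule bexE)
    note cc = coboundary[THEN bspec, THEN bspec]
    have c_cl: "c (K #>\<^bsub>G\<^esub> g) \<in> carrier A" if "g \<in> carrier G" for g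
      using tor_simps(2)[OF funcset_mem[OF c G.rcoset_in_FactGroup[OF that]]] .
    define f where "f = (\<lambda>g h. \<kappa> (G.kernel_part g) \<otimes>\<^bsub>A\<^esub> inv\<^bsub>A\<^esub> \<mu> (H.kernel_part h) \<otimes>\<^bsub>A\<^esub> c (K #>\<^bsub>G\<^esub> g))"
    have f_cl: "f g h \<in> carrier A" if "g \<in> carrier G" "h \<in> carrier H" for g h
      using that by (simp add: f_def c_cl \<kappa>_cl \<mu>_cl)
    have f_mult: "f (g \<otimes>\<^bsub>G\<^esub> g') (h \<otimes>\<^bsub>H\<^esub> h') = f g h \<otimes>\<^bsub>A\<^esub> f g' h'"
      if gh: "(g, h) \<in> U" and gh': "(g', h') \<in> U" for g h g' h'
    proof -
      have g: "g \<in> carrier G" and h: "h \<in> carrier H" and g': "g' \<in> carrier G" and h': "h' \<in> carrier H"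
        using gh gh' sub by auto
      let ?x = "K #>\<^bsub>G\<^esub> g" and ?y = "K #>\<^bsub>G\<^esub> g'" and ?z = "K #>\<^bsub>G\<^esub> (g \<otimes>\<^bsub>G\<^esub> g')"
      let ?a = "\<alpha> (?x, ?y)" and ?b = "\<beta> (L #>\<^bsub>H\<^esub> h, L #>\<^bsub>H\<^esub> h')"
      have x: "?x \<in> carrier (G Mod K)" and y: "?y \<in> carrier (G Mod K)"
        by (rule G.rcoset_in_FactGroup[OF g], rule G.rcoset_in_FactGroup[OF g'])
      have a: "?a \<in> K" using x y by simp
      have b: "?b \<in> L" using h h' by (simp add: H.rcoset_in_FactGroup)
      have "\<kappa> ?a \<otimes>\<^bsub>A\<^esub> c ?z = c ?x \<otimes>\<^bsub>A\<^esub> c ?y \<otimes>\<^bsub>A\<^esub> \<mu> ?b"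
        using cc[OF x y] g g' by (simp add: G.rcos_sum \<eta>'_coset[OF gh] \<eta>'_coset[OF gh'])
      moreover have cl: "\<kappa> ?a \<in> carrier A" "\<mu> ?b \<in> carrier A" "c ?x \<in> carrier A" "c ?y \<in> carrier A" "c ?z \<in> carrier A"
        using a b g g' by (simp_all add: \<kappa>_cl \<mu>_cl c_cl)
      ultimately have "c ?x \<otimes>\<^bsub>A\<^esub> c ?y = \<kappa> ?a \<otimes>\<^bsub>A\<^esub> c ?z \<otimes>\<^bsub>A\<^esub> inv\<^bsub>A\<^esub> \<mu> ?b"
        using A.inv_solve_right[of "c ?x \<otimes>\<^bsub>A\<^esub> c ?y" "\<kappa> ?a \<otimes>\<^bsub>A\<^esub> c ?z" "\<mu> ?b"] by simp
      hence e: "c ?x \<otimes>\<^bsub>A\<^esub> c ?y = \<kappa> ?a \<otimes>\<^bsub>A\<^esub> inv\<^bsub>A\<^esub> \<mu> ?b \<otimes>\<^bsub>A\<^esub> c ?z"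
        using cl by (simp add: A.m_ac)
      let ?k = "\<kappa> (G.kernel_part g)" and ?k' = "\<kappa> (G.kernel_part g')"
        and ?l = "\<mu> (H.kernel_part h)" and ?l' = "\<mu> (H.kernel_part h')"
      have kl: "?k \<in> carrier A" "?k' \<in> carrier A" "?l \<in> carrier A" "?l' \<in> carrier A"
        using g h g' h' by (simp_all add: \<kappa>_cl \<mu>_cl)
      have "f (g \<otimes>\<^bsub>G\<^esub> g') (h \<otimes>\<^bsub>H\<^esub> h')
          = (?k \<otimes>\<^bsub>A\<^esub> ?k' \<otimes>\<^bsub>A\<^esub> \<kappa> ?a) \<otimes>\<^bsub>A\<^esub> inv\<^bsub>A\<^esub> (?l \<otimes>\<^bsub>A\<^esub> ?l' \<otimes>\<^bsub>A\<^esub> \<mu> ?b) \<otimes>\<^bsub>A\<^esub> c ?z"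
        using g g' h h' a b by (simp add: f_def G.kernel_part_mult H.kernel_part_mult \<kappa>_mult \<mu>_mult)
      also have "\<dots> = ?k \<otimes>\<^bsub>A\<^esub> ?k' \<otimes>\<^bsub>A\<^esub> inv\<^bsub>A\<^esub> ?l \<otimes>\<^bsub>A\<^esub> inv\<^bsub>A\<^esub> ?l' \<otimes>\<^bsub>A\<^esub> (\<kappa> ?a \<otimes>\<^bsub>A\<^esub> inv\<^bsub>A\<^esub> \<mu> ?b \<otimes>\<^bsub>A\<^esub> c ?z)"
        using kl cl by (simp add: A.inv_mult A.m_ac)
      also have "\<dots> = ?k \<otimes>\<^bsub>A\<^esub> ?k' \<otimes>\<^bsub>A\<^esub> inv\<^bsub>A\<^esub> ?l \<otimes>\<^bsub>A\<^esub> inv\<^bsub>A\<^esub> ?l' \<otimes>\<^bsub>A\<^esub> (c ?x \<otimes>\<^bsub>A\<^esub> c ?y)"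
        by (simp only: e)
      also have "\<dots> = f g h \<otimes>\<^bsub>A\<^esub> f g' h'"
        using kl cl by (simp add: f_def A.m_ac)
      finally show ?thesis .
    qed
    \<comment> \<open>Since \<open>\<sigma>\<close> and \<open>\<tau>\<close> may be non-normalized, \<open>f\<close> does not visibly restrict to \<open>\<kappa>\<close> and \<open>\<mu>\<inverse>\<close>.
      Multiplicativity forces its value at the identity to be trivial, and translation by \<open>K \<times> L\<close>
      then gives the restriction.\<close>
    have f_one: "f \<one>\<^bsub>G\<^esub> \<one>\<^bsub>H\<^esub> = \<one>\<^bsub>A\<^esub>"
      using f_mult[of "\<one>\<^bsub>G\<^esub>" "\<one>\<^bsub>H\<^esub>" "\<one>\<^bsub>G\<^esub>" "\<one>\<^bsub>H\<^esub>"] subgroup.one_closed[OF U(1)] f_cl[of "\<one>\<^bsub>G\<^esub>" "\<one>\<^bsub>H\<^esub>"] by simp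
    have f_kernel: "f (k \<otimes>\<^bsub>G\<^esub> g) (l \<otimes>\<^bsub>H\<^esub> h) = \<kappa> k \<otimes>\<^bsub>A\<^esub> inv\<^bsub>A\<^esub> \<mu> l \<otimes>\<^bsub>A\<^esub> f g h"
      if k: "k \<in> K" and l: "l \<in> L" and g: "g \<in> carrier G" and h: "h \<in> carrier H" for k l g h
    proof -
      have "f (k \<otimes>\<^bsub>G\<^esub> g) (l \<otimes>\<^bsub>H\<^esub> h) =
        (\<kappa> k \<otimes>\<^bsub>A\<^esub> \<kappa> (G.kernel_part g)) \<otimes>\<^bsub>A\<^esub> inv\<^bsub>A\<^esub> (\<mu> l \<otimes>\<^bsub>A\<^esub> \<mu> (H.kernel_part h)) \<otimes>\<^bsub>A\<^esub> c (K #>\<^bsub>G\<^esub> g)"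
        using k l g h by (simp add: f_def G.kernel_part_kernel_mult H.kernel_part_kernel_mult
            G.rcoset_mult_kernel \<kappa>_mult \<mu>_mult)
      moreover have "\<kappa> k \<in> carrier A" "\<mu> l \<in> carrier A" "c (K #>\<^bsub>G\<^esub> g) \<in> carrier A"
        "\<kappa> (G.kernel_part g) \<in> carrier A" "\<mu> (H.kernel_part h) \<in> carrier A"
        using k l g h by (simp_all add: \<kappa>_cl \<mu>_cl c_cl)
      ultimately show ?thesis by (simp add: f_def A.inv_mult A.m_ac)
    qed
    have \<kappa>_one: "\<kappa> \<one>\<^bsub>G\<^esub> = \<one>\<^bsub>A\<^esub>"
      using \<kappa>_mult[of "\<one>\<^bsub>G\<^esub>" "\<one>\<^bsub>G\<^esub>"] \<kappa>_cl[of "\<one>\<^bsub>G\<^esub>"] by simp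
    have \<mu>_one: "\<mu> \<one>\<^bsub>H\<^esub> = \<one>\<^bsub>A\<^esub>"
      using \<mu>_mult[of "\<one>\<^bsub>H\<^esub>" "\<one>\<^bsub>H\<^esub>"] \<mu>_cl[of "\<one>\<^bsub>H\<^esub>"] by simp
    have fK: "f k \<one>\<^bsub>H\<^esub> = \<kappa> k" if "k \<in> K" for k
      using f_kernel[OF that H.subgroup_axioms[THEN subgroup.one_closed] G.one_closed H.one_closed] that by (simp add: f_one \<mu>_one \<kappa>_cl)
    have fL: "f \<one>\<^bsub>G\<^esub> l = inv\<^bsub>A\<^esub> \<mu> l" if "l \<in> L" for l
      using f_kernel[OF G.subgroup_axioms[THEN subgroup.one_closed] that G.one_closed H.one_closed] that by (simp add: f_one \<kappa>_one \<mu>_cl)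
    define \<phi> where "\<phi> = (\<lambda>(g, h) \<in> U. f g h)"
    have \<phi>_eq: "\<phi> (g, h) = f g h" if "(g, h) \<in> U" for g h using that by (simp add: \<phi>_def)
    have "\<phi> \<in> hom ((G \<times>\<times> H)\<lparr>carrier := U\<rparr>) A"
    proof (rule homI)
      show "\<phi> u \<in> carrier A" if "u \<in> carrier ((G \<times>\<times> H)\<lparr>carrier := U\<rparr>)" for u
        using that sub f_cl by (cases u) (auto simp: \<phi>_eq)
      show "\<phi> (u \<otimes>\<^bsub>(G \<times>\<times> H)\<lparr>carrier := U\<rparr>\<^esub> v) = \<phi> u \<otimes>\<^bsub>A\<^esub> \<phi> v"
        if "u \<in> carrier ((G \<times>\<times> H)\<lparr>carrier := U\<rparr>)" "v \<in> carrier ((G \<times>\<times> H)\<lparr>carrier := U\<rparr>)" for u v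
        using that mU f_mult by (cases u; cases v) (simp add: \<phi>_eq)
    qed
    hence "\<phi> \<in> dual A ((G \<times>\<times> H)\<lparr>carrier := U\<rparr>)"
      by (simp add: dual_def \<phi>_def)
    moreover have "phi1 H U \<phi> = \<kappa>"
    proof -
      have "phi1 H U \<phi> = restrict \<kappa> K"
        unfolding phi1_def U(4) by (rule restrict_ext) (simp add: \<phi>_def KU fK)
      also have "\<dots> = \<kappa>" using \<kappa> by (simp add: dual_def extensional_restrict)
      finally show ?thesis .
    qed
    moreover have "phi2 A G U \<phi> = \<mu>"
    proof -
      have "phi2 A G U \<phi> = restrict \<mu> L"
        unfolding phi2_def U(5) by (rule restrict_ext) (simp add: \<phi>_def LU fL \<mu>_cl)
      also have "\<dots> = \<mu>" using \<mu> by (simp add: dual_def extensional_restrict)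
      finally show ?thesis .
    qed
    ultimately show ?character by blast
  qed
qed


section \<open>Linked triples and cohomology\<close>

theorem proposition5p3:
  fixes A :: "('a, 'n) monoid_scheme"
    and G :: "('g, 'm) monoid_scheme"
    and H :: "('h, 'l) monoid_scheme"
    and K :: "'g set" and \<kappa> :: "'g \<Rightarrow> 'a"
    and L :: "'h set" and lam :: "'h \<Rightarrow> 'a"
    and \<alpha> :: "'g set \<times> 'g set \<Rightarrow> 'g"
    and \<beta> :: "'h set \<times> 'h set \<Rightarrow> 'h"
  assumes "comm_group A"
    and "group G" and "finite (carrier G)"
    and "group H" and "finite (carrier H)"
    and "(K, \<kappa>) \<in> fixed_char_pairs A G"
    and "(L, lam) \<in> fixed_char_pairs A H"
    and "inj_on \<kappa> K" and "inj_on lam L"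
    and "\<alpha> \<in> Z2 (G Mod K) (G\<lparr>carrier := K\<rparr>)" and "describes_extension G K \<alpha>"
    and "\<beta> \<in> Z2 (H Mod L) (H\<lparr>carrier := L\<rparr>)" and "describes_extension H L \<beta>"
  shows "linked A (G, K, \<kappa>) (H, L, lam) \<longleftrightarrow>
    (\<exists>\<eta> \<in> iso (H Mod L) (G Mod K).
       let Q = G Mod K; \<eta>' = inv_into (carrier (H Mod L)) \<eta>
       in H2_class Q (tor A) (restrict (\<kappa> \<circ> \<alpha>) (carrier Q \<times> carrier Q)) =
          H2_class Q (tor A) (restrict (lam \<circ> \<beta> \<circ> map_prod \<eta>' \<eta>') (carrier Q \<times> carrier Q)))"
proof -
  have nK: "K \<lhd> G" and \<kappa>: "\<kappa> \<in> dual A (G\<lparr>carrier := K\<rparr>)"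
    using assms(6) by (auto simp: fixed_char_pairs_def char_pairs_def)
  have nL: "L \<lhd> H" and lam: "lam \<in> dual A (H\<lparr>carrier := L\<rparr>)"
    using assms(7) by (auto simp: fixed_char_pairs_def char_pairs_def)
  obtain \<sigma> where \<sigma>: "central_section K G \<sigma> \<alpha>"
    using central_section_exists[OF assms(2,6,8,10,11)] by blast
  obtain \<tau> where \<tau>: "central_section L H \<tau> \<beta>"
    using central_section_exists[OF assms(4,7,9,12,13)] by blast
  have Q: "group (G Mod K)" and R: "group (H Mod L)"
    using nK nL by (simp_all add: normal.factorgroup_is_group)
  let ?Q = "G Mod K"
  have "(\<exists>\<phi> \<in> dual A ((G \<times>\<times> H)\<lparr>carrier := coset_graph G K H L \<eta>\<rparr>).
           phi1 H (coset_graph G K H L \<eta>) \<phi> = \<kappa> \<and> phi2 A G (coset_graph G K H L \<eta>) \<phi> = lam) \<longleftrightarrow>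
        (let Q = ?Q; \<eta>' = inv_into (carrier (H Mod L)) \<eta>
         in H2_class Q (tor A) (restrict (\<kappa> \<circ> \<alpha>) (carrier Q \<times> carrier Q)) =
            H2_class Q (tor A) (restrict (lam \<circ> \<beta> \<circ> map_prod \<eta>' \<eta>') (carrier Q \<times> carrier Q)))"
    if \<eta>: "\<eta> \<in> iso (H Mod L) ?Q" for \<eta>
  proof -
    define \<eta>' where "\<eta>' = inv_into (carrier (H Mod L)) \<eta>"
    have \<eta>': "\<eta>' \<in> hom ?Q (H Mod L)"
      using group.iso_set_sym[OF R \<eta>] by (simp add: \<eta>'_def iso_def)
    have \<eta>'_closed: "\<eta>' x \<in> carrier (H Mod L)" if "x \<in> carrier ?Q" for x
      using \<eta>' that by (auto simp: hom_def)
    let ?f = "restrict (\<kappa> \<circ> \<alpha>) (carrier ?Q \<times> carrier ?Q)"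
    let ?g = "restrict (lam \<circ> \<beta> \<circ> map_prod \<eta>' \<eta>') (carrier ?Q \<times> carrier ?Q)"
    have f: "?f \<in> Z2 ?Q (tor A)"
      by (rule char_comp_Z2[OF assms(1-3,6,10)])
    have "restrict (restrict (lam \<circ> \<beta>) (carrier (H Mod L) \<times> carrier (H Mod L)) \<circ> map_prod \<eta>' \<eta>')
        (carrier ?Q \<times> carrier ?Q) = ?g"
      using \<eta>'_closed by (intro restrict_ext) auto
    hence g: "?g \<in> Z2 ?Q (tor A)"
      using pullback_Z2[OF Q R \<eta>' char_comp_Z2[OF assms(1,4,5,7,12)]] by simp
    have "H2_class ?Q (tor A) ?f = H2_class ?Q (tor A) ?g \<longleftrightarrow>
      (\<exists>c \<in> carrier ?Q \<rightarrow> carrier (tor A). \<forall>x \<in> carrier ?Q. \<forall>y \<in> carrier ?Q.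
         \<kappa> (\<alpha> (x, y)) \<otimes>\<^bsub>A\<^esub> c (x \<otimes>\<^bsub>?Q\<^esub> y) = c x \<otimes>\<^bsub>A\<^esub> c y \<otimes>\<^bsub>A\<^esub> lam (\<beta> (\<eta>' x, \<eta>' y)))"
      unfolding H2_class_eq_iff[OF Q comm_group_tor[OF assms(1)] f g]
      by (intro bex_cong ball_cong refl) (simp add: tor_simps del: mult_FactGroup)
    with character_on_coset_graph_iff[OF assms(1,3,5) \<sigma> \<tau> \<kappa> lam \<eta>, folded \<eta>'_def]
    show ?thesis
      unfolding Let_def \<eta>'_def[symmetric] by (rule trans[OF _ sym])
  qed
  thus ?thesis
    unfolding linked_iff_coset_graph[OF nK nL] by (rule bex_cong[OF refl])
qed

end
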